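(* Let $\mu=N_d(A)$ and $\nu=N_d(B)$ be two centered Gaussian measures on $\mathbb{R}^d$ with full-rank covariance matrices $A$ and $B$, let $\Sigma\in S_{2d}^{++}(\mathbb{R})$ and $\varepsilon>0$. Write $\Gamma:=\Sigma^{-1}=\begin{pmatrix}\Gamma_{11}&\Gamma_{12}\\ \Gamma_{12}^T&\Gamma_{22}\end{pmatrix}$ with $d\times d$ blocks and $M_\varepsilon:=I_d-\varepsilon\Gamma_{12}$. Then the entropic optimal transport problem $$W_\Sigma^\varepsilon(\mu,\nu):=\inf_{\pi\in\Pi(\mu,\nu)}\int_{\mathbb{R}^d\times\mathbb{R}^d}\|x-y\|^2\,d\pi(x,y)+2\varepsilon\,\mathrm{KL}(\pi\,|\,N_{2d}(\Sigma))$$ has the dual formulation $$\begin{aligned}W_\Sigma^\varepsilon(\mu,\nu)=\max_{(F,G)}\;&\left\{\langle I_d-F,A\rangle_{\mathrm{HS}}+\langle I_d-G,B\rangle_{\mathrm{HS}}+\varepsilon\log\det\begin{pmatrix}F&-M_\varepsilon\\-M_\varepsilon^T&G\end{pmatrix}\right\}\\&+\varepsilon\left[\langle\Gamma_{11},A\rangle_{\mathrm{HS}}+\langle\Gamma_{22},B\rangle_{\mathrm{HS}}-\log\det(\varepsilon\Sigma^{-1})\right],\end{aligned}$$ where the maximum runs over all pairs $(F,G)\in S_d^{++}(\mathbb{R})\times S_d^{++}(\mathbb{R})$.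
   Context: $S_{k}^{++}(\mathbb{R})$ is the set of real symmetric positive-definite $k\times k$ matrices; $\langle P,Q\rangle_{\mathrm{HS}}:=\mathrm{tr}(PQ^T)$. $N_d(A)$ denotes the centered Gaussian measure on $\mathbb{R}^d$ with covariance $A$, and $N_{2d}(\Sigma)$ the centered Gaussian measure on $\mathbb{R}^d\times\mathbb{R}^d$ with covariance $\Sigma$. $\Pi(\mu,\nu)$ is the set of probability measures on $\mathbb{R}^d\times\mathbb{R}^d$ with first marginal $\mu$ and second marginal $\nu$. $\mathrm{KL}(\pi|\pi_{\mathrm{ref}}):=\int\log\left(\frac{d\pi}{d\pi_{\mathrm{ref}}}\right)d\pi$ if $\pi$ is absolutely continuous with respect to $\pi_{\mathrm{ref}}$, and $+\infty$ otherwise. In the dual objective, $\log\det$ of a symmetric matrix that is not positive-definite is taken to be $-\infty$. *)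

theory Defs
  imports "HOL-Probability.Probability"
begin

definition spd :: "(real^'k^'k) set" where
  "spd = {P. transpose P = P \<and> (\<forall>x. x \<noteq> 0 \<longrightarrow> 0 < x \<bullet> (P *v x))}"

definition hs_inner :: "real^'k^'k \<Rightarrow> real^'k^'k \<Rightarrow> real" where
  "hs_inner P Q = trace (P ** transpose Q)"

definition logdet :: "real^'k^'k \<Rightarrow> ereal" where
  "logdet P = (if P \<in> spd then ereal (ln (det P)) else - \<infinity>)"


text \<open>The index type \<open>'n + 'n\<close> stands for the \<open>2d\<close> coordinates, where \<open>d = CARD('n)\<close>:
  \<open>Inl\<close> indexes the first \<open>d\<close> of them and \<open>Inr\<close> the last \<open>d\<close>.\<close>

definition stack :: "real^'n \<Rightarrow> real^'n \<Rightarrow> real^('n + 'n)" where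
  "stack x y = (\<chi> k. case k of Inl i \<Rightarrow> x $ i | Inr i \<Rightarrow> y $ i)"

definition block_matrix ::
    "real^'n^'n \<Rightarrow> real^'n^'n \<Rightarrow> real^'n^'n \<Rightarrow> real^'n^'n \<Rightarrow> real^('n + 'n)^('n + 'n)" where
  "block_matrix P Q R S =
     (\<chi> k. case k of Inl i \<Rightarrow> stack (P $ i) (Q $ i) | Inr i \<Rightarrow> stack (R $ i) (S $ i))"

definition block11 :: "real^('n + 'n)^('n + 'n) \<Rightarrow> real^'n^'n" where
  "block11 P = (\<chi> i j. P $ Inl i $ Inl j)"

definition block12 :: "real^('n + 'n)^('n + 'n) \<Rightarrow> real^'n^'n" where
  "block12 P = (\<chi> i j. P $ Inl i $ Inr j)"

definition block22 :: "real^('n + 'n)^('n + 'n) \<Rightarrow> real^'n^'n" where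
  "block22 P = (\<chi> i j. P $ Inr i $ Inr j)"


text \<open>Centered Gaussian measures, given by their Lebesgue densities; the formula is the Gaussian
  density only for a covariance in \<^const>\<open>spd\<close>.\<close>

definition gaussian_density :: "real^'k^'k \<Rightarrow> real^'k \<Rightarrow> real" where
  "gaussian_density C x =
     exp (- (x \<bullet> (matrix_inv C *v x)) / 2) / sqrt ((2 * pi) ^ CARD('k) * det C)"

definition gaussian :: "real^'k^'k \<Rightarrow> (real^'k) measure" where
  "gaussian C = density lborel (\<lambda>x. ennreal (gaussian_density C x))"

definition gaussian_prod :: "real^('n + 'n)^('n + 'n) \<Rightarrow> ((real^'n) \<times> (real^'n)) measure" where
  "gaussian_prod C = density lborel (\<lambda>(x, y). ennreal (gaussian_density C (stack x y)))"


definition couplings ::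
    "'a::topological_space measure \<Rightarrow> 'b::topological_space measure \<Rightarrow> ('a \<times> 'b) measure set" where
  "couplings \<mu> \<nu> = {\<pi>. prob_space \<pi> \<and> sets \<pi> = sets borel \<and>
     distr \<pi> borel fst = \<mu> \<and> distr \<pi> borel snd = \<nu>}"

text \<open>Relative entropy with values in the extended reals. The Bochner integral behind
  \<^const>\<open>KL_divergence\<close> returns 0 for non-integrable functions, so the integral of
  \<open>log (d\<pi>/d\<rho>)\<close> is taken as positive part minus negative part. For probability measures the
  negative part is always finite, hence \<open>\<infinity> - \<infinity>\<close> does not occur. Note the argument order of
  \<^const>\<open>absolutely_continuous\<close> and \<^const>\<open>entropy_density\<close>: the reference measure comes first.\<close>

definition KL :: "'a measure \<Rightarrow> 'a measure \<Rightarrow> ereal" where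
  "KL \<pi> \<rho> = (if absolutely_continuous \<rho> \<pi>
     then enn2ereal (\<integral>\<^sup>+z. ennreal (entropy_density (exp 1) \<rho> \<pi> z) \<partial>\<pi>)
        - enn2ereal (\<integral>\<^sup>+z. ennreal (- entropy_density (exp 1) \<rho> \<pi> z) \<partial>\<pi>)
     else \<infinity>)"

definition eot ::
    "real \<Rightarrow> real^('n + 'n)^('n + 'n) \<Rightarrow> (real^'n) measure \<Rightarrow> (real^'n) measure \<Rightarrow> ereal" where
  "eot \<epsilon> \<Sigma> \<mu> \<nu> = (INF \<pi>\<in>couplings \<mu> \<nu>.
     enn2ereal (\<integral>\<^sup>+(x, y). ennreal ((norm (x - y))\<^sup>2) \<partial>\<pi>) + ereal (2 * \<epsilon>) * KL \<pi> (gaussian_prod \<Sigma>))"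

definition dual_objective ::
    "real \<Rightarrow> real^('n + 'n)^('n + 'n) \<Rightarrow> real^'n^'n \<Rightarrow> real^'n^'n \<Rightarrow> real^'n^'n \<Rightarrow> real^'n^'n \<Rightarrow> ereal" where
  "dual_objective \<epsilon> \<Sigma> A B F G =
     (let M = mat 1 - \<epsilon> *\<^sub>R block12 (matrix_inv \<Sigma>)
      in ereal (hs_inner (mat 1 - F) A + hs_inner (mat 1 - G) B)
         + ereal \<epsilon> * logdet (block_matrix F (- M) (- transpose M) G))"

end

theory Submission
  imports Defs
begin

text \<open>For \<open>(F, G)\<close> let \<open>M = I - \<epsilon> \<Gamma>\<^sub>1\<^sub>2\<close>, let \<open>K\<close> be the block matrix of the dual objective, assume that
\<open>K\<close> is positive definite, and put \<open>S = \<epsilon> K\<^sup>-\<^sup>1\<close>. Expanding the Gaussian densities gives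
\<open>\<bar>x - y\<bar>\<^sup>2 + 2 \<epsilon> ln (dN(S) / dN(\<Sigma>)) (x, y) = x \<bullet> (I - F + \<epsilon> \<Gamma>\<^sub>1\<^sub>1) x + y \<bullet> (I - G + \<epsilon> \<Gamma>\<^sub>2\<^sub>2) y + const\<close>:
the choice of \<open>M\<close> is exactly what cancels the mixed terms \<open>x \<bullet> y\<close> (\<open>cost_plus_log_ratio\<close>). The
right-hand side separates, so every coupling of \<open>N(A)\<close> and \<open>N(B)\<close> gives it the same integral,
and this integral is the value of the dual at \<open>(F, G)\<close>, including the additive constant of the
theorem (\<open>coupling_cost_plus_log_ratio\<close>).

Gibbs' inequality \<open>KL(\<pi> | N(\<Sigma>)) \<ge> \<integral> ln (dN(S) / dN(\<Sigma>)) d\<pi>\<close> therefore yields weak duality for every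
coupling \<open>\<pi>\<close> and every \<open>(F, G)\<close> (\<open>weak_duality\<close>). It is an equality for \<open>\<pi> = N(S)\<close>, which is
admissible as soon as the diagonal blocks of \<open>S\<close> are \<open>A\<close> and \<open>B\<close>
(\<open>gaussian_prod_attains_dual_value\<close>). A single pair \<open>(S, K)\<close> that satisfies both constraints thus
solves the primal and the dual problem at once.

It remains to find a positive definite \<open>S\<close> with diagonal blocks \<open>A\<close> and \<open>B\<close> whose inverse has
off-diagonal block \<open>- M / \<epsilon>\<close> (\<open>exists_covariance_with_marginals\<close>). Its off-diagonal block \<open>C\<close> is
a maximiser of \<open>2 tr ((M / \<epsilon>)\<^sup>T C) + ln det\<close> over the compact set of those \<open>C\<close> for which the block matrix
is positive semidefinite; the condition on the inverse is the first-order condition.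

The Gaussian facts that enter are the total mass and the second moments of \<open>N(C)\<close>, obtained from
the standard Gaussian by a linear change of variables (\<open>gaussian_linear_image\<close>), and the marginals
of \<open>N(S)\<close>, obtained by completing the square (\<open>gaussian_prod_marginals\<close>).\<close>

section \<open>Linear change of variables for Lebesgue measure\<close>

lemma Basis_cart: "(Basis :: (real^'n) set) = range (\<lambda>i. axis i 1)"
  by (auto simp: Basis_vec_def)

lemma prod_Basis_cart:
  "(\<Prod>b\<in>(Basis :: (real^'n) set). F b) = (\<Prod>i\<in>UNIV. F (axis i 1))"
  unfolding Basis_cart by (subst prod.reindex) (auto simp: inj_on_def axis_eq_axis)

lemma nn_integral_lborel_shift:
  fixes g :: "'a::euclidean_space \<Rightarrow> ennreal"
  assumes [measurable]: "g \<in> borel_measurable borel"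
  shows "(\<integral>\<^sup>+x. g (x + a) \<partial>lborel) = (\<integral>\<^sup>+x. g x \<partial>lborel)"
proof -
  have "(\<integral>\<^sup>+x. g x \<partial>lborel) = (\<integral>\<^sup>+x. g x \<partial>(distr lborel borel ((+) a)))"
    by (simp add: lborel_distr_plus)
  also have "\<dots> = (\<integral>\<^sup>+x. g (x + a) \<partial>lborel)"
    by (simp add: nn_integral_distr add.commute)
  finally show ?thesis ..
qed

lemma nn_integral_lborel_reflect:
  fixes g :: "'a::euclidean_space \<Rightarrow> ennreal"
  assumes [measurable]: "g \<in> borel_measurable borel"
  shows "(\<integral>\<^sup>+x. g (a - x) \<partial>lborel) = (\<integral>\<^sup>+x. g x \<partial>lborel)"
proof -
  have "(\<integral>\<^sup>+x. g x \<partial>lborel) =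
      (\<integral>\<^sup>+x. g x \<partial>(density (distr lborel borel (\<lambda>x. a + (-1) *\<^sub>R x)) (\<lambda>_. ennreal (\<bar>-1\<bar> ^ DIM('a)))))"
    by (rule arg_cong[where f="\<lambda>M. integral\<^sup>N M g"]) (rule lborel_affine, simp)
  also have "\<dots> = (\<integral>\<^sup>+x. g (a - x) \<partial>lborel)"
    by (simp add: nn_integral_density nn_integral_distr)
  finally show ?thesis ..
qed

lemma linear_borel_measurable:
  fixes f :: "'a::euclidean_space \<Rightarrow> 'b::euclidean_space"
  assumes "linear f" shows "f \<in> borel_measurable borel"
  using assms
  by (simp add: borel_measurable_continuous_onI linear_continuous_on linear_conv_bounded_linear)

text \<open>The uniqueness argument for Haar measure: the pull-back of Lebesgue measure along \<open>f\<close> is again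
translation invariant, and two translation-invariant measures are proportional. Cross-multiplying
avoids naming the factor of proportionality. The proof computes
\<open>\<integral>\<integral> h (f x) g (y + f x)\<close> in two ways, where the inner translation by \<open>y\<close> is realised by a
translation of \<open>x\<close>.\<close>

lemma nn_integral_linear_image_swap:
  fixes f :: "'a::euclidean_space \<Rightarrow> 'a"
  assumes "linear f" and "surj f"
    and [measurable]: "g \<in> borel_measurable borel" "h \<in> borel_measurable borel"
  shows "(\<integral>\<^sup>+x. h (f x) \<partial>lborel) * (\<integral>\<^sup>+x. g x \<partial>lborel) =
    (\<integral>\<^sup>+x. h x \<partial>lborel) * (\<integral>\<^sup>+x. (g (f x) :: ennreal) \<partial>lborel)"
proof -
  interpret linear f by fact
  have [measurable]: "f \<in> borel \<rightarrow>\<^sub>M borel"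
    by (rule linear_borel_measurable) fact
  have "(\<integral>\<^sup>+x. h (f x) \<partial>lborel) * (\<integral>\<^sup>+x. g x \<partial>lborel)
      = (\<integral>\<^sup>+x. (\<integral>\<^sup>+y. h (f x) * g (y + f x) \<partial>lborel) \<partial>lborel)"
    by (simp add: nn_integral_cmult nn_integral_multc nn_integral_lborel_shift)
  also have "\<dots> = (\<integral>\<^sup>+y. (\<integral>\<^sup>+x. h (f x) * g (y + f x) \<partial>lborel) \<partial>lborel)"
    by (rule lborel_pair.Fubini'[symmetric]) simp
  also have "\<dots> = (\<integral>\<^sup>+y. (\<integral>\<^sup>+x. h (f x - y) * g (f x) \<partial>lborel) \<partial>lborel)"
  proof (rule nn_integral_cong)
    fix y
    obtain v where "y = f v" using \<open>surj f\<close> by (metis surjD)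
    then have "h (f x) * g (y + f x) = (\<lambda>x. h (f x - y) * g (f x)) (x + v)" for x
      by (simp add: add algebra_simps)
    then show "(\<integral>\<^sup>+x. h (f x) * g (y + f x) \<partial>lborel) = (\<integral>\<^sup>+x. h (f x - y) * g (f x) \<partial>lborel)"
      using nn_integral_lborel_shift[of "\<lambda>x. h (f x - y) * g (f x)" v] by simp
  qed
  also have "\<dots> = (\<integral>\<^sup>+x. (\<integral>\<^sup>+y. h (f x - y) * g (f x) \<partial>lborel) \<partial>lborel)"
    by (rule lborel_pair.Fubini') simp
  also have "\<dots> = (\<integral>\<^sup>+x. h x \<partial>lborel) * (\<integral>\<^sup>+x. g (f x) \<partial>lborel)"
    by (simp add: nn_integral_cmult nn_integral_multc nn_integral_lborel_reflect)
  finally show ?thesis .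
qed

text \<open>The factor by which \<open>f\<close> scales Lebesgue measure is its own inverse, so it is 1. This settles the
two elementary maps, transpositions and shears, whose image of a box is awkward to measure.\<close>

lemma nn_integral_linear_involution:
  fixes f :: "'a::euclidean_space \<Rightarrow> 'a"
  assumes "linear f" and inv: "\<And>x. f (f x) = x"
    and [measurable]: "g \<in> borel_measurable borel"
  shows "(\<integral>\<^sup>+x. g (f x) \<partial>lborel) = (\<integral>\<^sup>+x. (g x :: ennreal) \<partial>lborel)"
proof -
  have [measurable]: "f \<in> borel \<rightarrow>\<^sub>M borel"
    by (rule linear_borel_measurable) fact
  have "surj f" using inv by (metis surjI)
  \<comment> \<open>taking \<open>h = g \<circ> f\<close> makes both sides of the proportionality squares\<close>
  have sq: "(\<integral>\<^sup>+x. g x \<partial>lborel)^2 = (\<integral>\<^sup>+x. g (f x) \<partial>lborel)^2"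
    using nn_integral_linear_image_swap[OF \<open>linear f\<close> \<open>surj f\<close>, of g "\<lambda>x. g (f x)"]
    by (simp add: inv power2_eq_square)
  have mono: "a \<le> b" if "a^2 = b^2" for a b :: ennreal
  proof (rule ccontr)
    assume "\<not> a \<le> b"
    then have "b < a" by simp
    then have "b^2 < a^2"
      by (cases a; cases b)
        (auto simp: ennreal_power ennreal_less_iff power_strict_mono ennreal_top_eq_mult_iff power2_eq_square
           ennreal_mult[symmetric] mult_strict_mono' ennreal_mult_less_top)
    with that show False by simp
  qed
  show ?thesis using mono[OF sq] mono[OF sq[symmetric]] by (rule antisym[OF _ _, rotated])
qed

text \<open>Both sides are multiplicative in \<open>f\<close>, which reduces the claim to elementary maps. Diagonal maps
are covered by the affine formula for Lebesgue measure and transpositions are involutions.\<close>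

theorem nn_integral_linear_change_of_variables:
  fixes f :: "real^'n \<Rightarrow> real^'n"
  assumes "linear f" and "det (matrix f) \<noteq> 0" and "g \<in> borel_measurable borel"
  shows "(\<integral>\<^sup>+x. g x \<partial>lborel) = ennreal \<bar>det (matrix f)\<bar> * (\<integral>\<^sup>+x. g (f x) \<partial>lborel)"
proof -
  define P where "P f \<longleftrightarrow> (det (matrix f) \<noteq> 0 \<longrightarrow> (\<forall>g\<in>borel_measurable borel.
      (\<integral>\<^sup>+x. g x \<partial>lborel) = ennreal \<bar>det (matrix f)\<bar> * (\<integral>\<^sup>+x. g (f x) \<partial>lborel)))"
    for f :: "real^'n \<Rightarrow> real^'n"
  have involution: "\<forall>g\<in>borel_measurable borel. (\<integral>\<^sup>+x. g (f x) \<partial>lborel) = (\<integral>\<^sup>+x. (g x :: ennreal) \<partial>lborel)"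
    if "linear f" "\<And>x. f (f x) = x" for f :: "real^'n \<Rightarrow> real^'n"
    using that nn_integral_linear_involution by blast
  have "P f"
  proof (rule induct_linear_elementary[OF \<open>linear f\<close>])
    fix f g :: "real^'n \<Rightarrow> real^'n"
    assume lin: "linear f" "linear g" and "P f" "P g"
    have [measurable]: "f \<in> borel \<rightarrow>\<^sub>M borel"
      by (rule linear_borel_measurable) fact
    have *: "det (matrix (f \<circ> g)) = det (matrix f) * det (matrix g)"
      using lin by (simp add: matrix_compose det_mul)
    show "P (f \<circ> g)"
      unfolding P_def
    proof (intro impI ballI)
      fix h :: "real^'n \<Rightarrow> ennreal"
      assume nz: "det (matrix (f \<circ> g)) \<noteq> 0" and [measurable]: "h \<in> borel_measurable borel"
      have nzf: "det (matrix f) \<noteq> 0" and nzg: "det (matrix g) \<noteq> 0"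
        using nz by (auto simp: *)
      have "(\<integral>\<^sup>+x. h x \<partial>lborel) = ennreal \<bar>det (matrix f)\<bar> * (\<integral>\<^sup>+x. h (f x) \<partial>lborel)"
        by (rule \<open>P f\<close>[unfolded P_def, rule_format]) (use nzf in simp_all)
      also have "(\<integral>\<^sup>+x. h (f x) \<partial>lborel) = ennreal \<bar>det (matrix g)\<bar> * (\<integral>\<^sup>+x. h (f (g x)) \<partial>lborel)"
        by (rule \<open>P g\<close>[unfolded P_def, rule_format, of "\<lambda>x. h (f x)"]) (use nzg in simp_all)
      finally show "(\<integral>\<^sup>+x. h x \<partial>lborel) = ennreal \<bar>det (matrix (f \<circ> g))\<bar> * (\<integral>\<^sup>+x. h ((f \<circ> g) x) \<partial>lborel)"
        by (simp add: * abs_mult ennreal_mult mult.assoc)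
    qed
  next
    fix f :: "real^'n \<Rightarrow> real^'n" and i
    assume "linear f" and "\<And>x. f x $ i = 0"
    then have "det (matrix f) = 0"
      by (intro det_zero_row(1)[of i]) (simp add: row_def matrix_def vec_eq_iff)
    then show "P f" by (simp add: P_def)
  next
    fix c :: "'n \<Rightarrow> real"
    let ?f = "\<lambda>x::real^'n. \<chi> i. c i * x $ i"
    have det: "det (matrix ?f) = (\<Prod>i\<in>UNIV. c i)"
      by (subst det_diagonal) (auto simp: matrix_def axis_def)
    define c' where "c' = (\<lambda>b::real^'n. (\<chi> i. c i) \<bullet> b)"
    have f: "?f x = 0 + (\<Sum>j\<in>Basis. (c' j * (x \<bullet> j)) *\<^sub>R j)" for x
    proof -
      have "(\<Sum>j\<in>Basis. (c' j * (x \<bullet> j)) *\<^sub>R j) = (\<Sum>j\<in>Basis. (?f x \<bullet> j) *\<^sub>R j)"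
        by (rule sum.cong) (auto simp: Basis_cart c'_def inner_axis)
      then show ?thesis by (simp add: euclidean_representation)
    qed
    have [measurable]: "?f \<in> borel \<rightarrow>\<^sub>M borel"
      by (intro borel_measurable_continuous_onI continuous_intros)
    show "P ?f"
      unfolding P_def
    proof (intro impI ballI)
      fix h :: "real^'n \<Rightarrow> ennreal"
      assume nz: "det (matrix ?f) \<noteq> 0" and [measurable]: "h \<in> borel_measurable borel"
      have "\<And>j. j \<in> Basis \<Longrightarrow> c' j \<noteq> 0"
        using nz unfolding det by (auto simp: Basis_cart c'_def inner_axis)
      then have "lborel = density (distr lborel borel ?f) (\<lambda>_. ennreal (\<Prod>j\<in>Basis. \<bar>c' j\<bar>))"
        unfolding f by (rule lborel_affine_euclidean)
      then have "(\<integral>\<^sup>+x. h x \<partial>lborel) = (\<integral>\<^sup>+x. h x \<partial>density (distr lborel borel ?f) (\<lambda>_. ennreal (\<Prod>j\<in>Basis. \<bar>c' j\<bar>)))"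
        by (rule arg_cong[where f="\<lambda>M. integral\<^sup>N M h"])
      also have "\<dots> = (\<Prod>j\<in>Basis. \<bar>c' j\<bar>) * (\<integral>\<^sup>+x. h (?f x) \<partial>lborel)"
        by (simp add: nn_integral_density nn_integral_distr nn_integral_cmult)
      also have "(\<Prod>j\<in>Basis. \<bar>c' j\<bar>) = \<bar>det (matrix ?f)\<bar>"
        unfolding det by (simp add: prod_Basis_cart c'_def inner_axis abs_prod)
      finally show "(\<integral>\<^sup>+x. h x \<partial>lborel) = ennreal \<bar>det (matrix ?f)\<bar> * (\<integral>\<^sup>+x. h (?f x) \<partial>lborel)" .
    qed
  next
    fix m n :: 'n
    assume "m \<noteq> n"
    let ?f = "\<lambda>x::real^'n. \<chi> i. x $ Transposition.transpose m n i"
    have "matrix ?f = (\<chi> i. (mat 1 :: real^'n^'n) $ Transposition.transpose m n i)"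
      by (auto simp: vec_eq_iff matrix_def mat_def axis_def)
    then have "\<bar>det (matrix ?f)\<bar> = 1"
      by (simp add: det_permute_rows permutes_swap_id abs_mult sign_swap_id \<open>m \<noteq> n\<close>)
    moreover have "linear ?f"
      by (rule linearI) (simp_all add: vec_eq_iff)
    ultimately show "P ?f"
      using involution[of ?f] by (simp add: P_def)
  next
    fix m n :: 'n
    assume "m \<noteq> n"
    let ?V = "\<lambda>x::real^'n. \<chi> i. if i = m then x $ m + x $ n else x $ i"
    let ?R = "\<lambda>x::real^'n. \<chi> i. if i = m then - x $ m else x $ i"
    have "matrix ?V = (\<chi> k. if k = m then row m (mat 1 :: real^'n^'n) + 1 *s row n (mat 1) else row k (mat 1))"
      by (simp add: vec_eq_iff matrix_def mat_def axis_def row_def)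
    then have det: "det (matrix ?V) = 1"
      by (simp only: det_row_operation[OF \<open>m \<noteq> n\<close>] det_I)
    have lin: "linear ?R" "linear (\<lambda>x. ?R (?V x))"
      by (rule linearI; simp add: vec_eq_iff algebra_simps)+
    have [measurable]: "?R \<in> borel \<rightarrow>\<^sub>M borel"
      by (rule linear_borel_measurable) fact
    \<comment> \<open>a shear is the product of two involutions, the reflection \<open>R\<close> and \<open>R \<circ> V\<close>\<close>
    have R: "?R (?R x) = x" and RV: "?R (?V (?R (?V x))) = x" for x
      using \<open>m \<noteq> n\<close> by (simp_all add: vec_eq_iff)
    have "(\<integral>\<^sup>+x. h (?V x) \<partial>lborel) = (\<integral>\<^sup>+x. h x \<partial>lborel)"
      if [measurable]: "h \<in> borel_measurable borel" for h :: "real^'n \<Rightarrow> ennreal"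
    proof -
      have "(\<integral>\<^sup>+x. h (?V x) \<partial>lborel) = (\<integral>\<^sup>+x. h (?R (?R (?V x))) \<partial>lborel)"
        by (simp only: R)
      also have "\<dots> = (\<integral>\<^sup>+x. h (?R x) \<partial>lborel)"
        by (rule nn_integral_linear_involution[OF lin(2) RV, of "\<lambda>x. h (?R x)"]) simp
      also have "\<dots> = (\<integral>\<^sup>+x. h x \<partial>lborel)"
        by (rule nn_integral_linear_involution[OF lin(1) R]) simp
      finally show ?thesis .
    qed
    then show "P ?V" by (simp add: P_def det)
  qed
  then show ?thesis using assms unfolding P_def by blast
qed

section \<open>Positive definite matrices\<close>

lemma spd_sym: "S \<in> spd \<Longrightarrow> transpose S = S"
  by (simp add: spd_def)

lemma spd_pos: "S \<in> spd \<Longrightarrow> x \<noteq> 0 \<Longrightarrow> 0 < x \<bullet> (S *v x)"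
  by (simp add: spd_def)

lemma spd_nonneg: "S \<in> spd \<Longrightarrow> 0 \<le> x \<bullet> (S *v x)"
  by (cases "x = 0") (auto dest: spd_pos less_imp_le)

lemma inner_matrix_vector_swap: "x \<bullet> (P *v y) = (transpose P *v x) \<bullet> (y :: real^'k)"
  by (simp add: dot_lmul_matrix)

lemma spd_inner_commute: "S \<in> spd \<Longrightarrow> x \<bullet> (S *v y) = y \<bullet> (S *v x)"
  by (metis inner_matrix_vector_swap spd_sym inner_commute)

lemma spd_invertible:
  assumes "S \<in> spd" shows "invertible S"
proof -
  have "x = 0" if "S *v x = 0" for x
    using spd_pos[OF assms, of x] that by (cases "x = 0") auto
  then show ?thesis
    by (metis invertible_left_inverse matrix_left_invertible_ker)
qed

lemma invertible_matrix_inv: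
  assumes "invertible S"
  shows "S ** matrix_inv S = mat 1" and "matrix_inv S ** S = mat 1"
  using someI_ex[OF assms[unfolded invertible_def]] by (simp_all add: matrix_inv_def)

lemmas spd_inv_right = invertible_matrix_inv(1)[OF spd_invertible]
  and spd_inv_left = invertible_matrix_inv(2)[OF spd_invertible]

lemma matrix_inv_unique:
  fixes S :: "real^'k^'k"
  assumes "S ** T = mat 1" shows "matrix_inv S = T"
proof -
  have "T ** S = mat 1" using assms by (simp add: matrix_left_right_inverse)
  then have "invertible S" using assms by (auto simp: invertible_def)
  have "matrix_inv S = matrix_inv S ** (S ** T)" using assms by simp
  also have "\<dots> = T"
    by (simp add: matrix_mul_assoc invertible_matrix_inv(2)[OF \<open>invertible S\<close>])
  finally show ?thesis .
qed

lemma spd_matrix_inv: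
  assumes "S \<in> spd" shows "matrix_inv S \<in> spd"
proof -
  have "transpose (matrix_inv S) = matrix_inv S"
    by (metis assms matrix_inv_unique matrix_transpose_mul spd_inv_left spd_sym transpose_mat)
  moreover have "0 < x \<bullet> (matrix_inv S *v x)" if "x \<noteq> 0" for x
  proof -
    let ?y = "matrix_inv S *v x"
    have x: "S *v ?y = x" by (simp add: matrix_vector_mul_assoc spd_inv_right[OF assms])
    then have "?y \<noteq> 0" using that by auto
    from spd_pos[OF assms this] show ?thesis by (simp only: x inner_commute)
  qed
  ultimately show ?thesis by (simp add: spd_def)
qed

lemma spd_scaleR: "S \<in> spd \<Longrightarrow> 0 < c \<Longrightarrow> c *\<^sub>R S \<in> spd"
  by (simp add: spd_def transpose_scalar scaleR_matrix_vector_assoc[symmetric])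

lemma spd_mat_1: "mat 1 \<in> spd"
  by (simp add: spd_def)

text \<open>Gram-Schmidt for the inner product \<open>(x, y) |-> x \<bullet> (S *v y)\<close>: the columns of \<open>T\<close> are an orthonormal
basis. The induction adds one index at a time, starting from any nonzero vector orthogonal to the
images under \<open>S\<close> of the vectors that are already chosen.\<close>

lemma spd_congruent_mat_1:
  fixes S :: "real^'k^'k"
  assumes "S \<in> spd"
  obtains T :: "real^'k^'k" where "transpose T ** S ** T = mat 1"
proof -
  have "\<exists>v :: 'k \<Rightarrow> real^'k. \<forall>i\<in>J. \<forall>j\<in>J. v i \<bullet> (S *v v j) = (if i = j then 1 else 0)" if "finite J" for J
    using that
  proof induction
    case (insert k J)
    then obtain v :: "'k \<Rightarrow> real^'k"
      where v: "\<And>i j. i \<in> J \<Longrightarrow> j \<in> J \<Longrightarrow> v i \<bullet> (S *v v j) = (if i = j then 1 else 0)" by blast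
    let ?B = "(\<lambda>j. S *v v j) ` J"
    have "dim ?B \<le> card J"
      using dim_le_card'[of ?B] card_image_le[OF \<open>finite J\<close>, of "\<lambda>j. S *v v j"] \<open>finite J\<close> by simp
    also have "\<dots> < card (UNIV :: 'k set)"
      by (rule psubset_card_mono) (use \<open>k \<notin> J\<close> in auto)
    finally have "dim ?B < DIM(real^'k)" by simp
    from orthogonal_to_subspace_exists[OF this] obtain w
      where "w \<noteq> 0" and w: "\<And>y. y \<in> span ?B \<Longrightarrow> orthogonal w y" by blast
    have wv: "w \<bullet> (S *v v j) = 0" if "j \<in> J" for j
      using w[OF span_base, of "S *v v j"] that by (simp add: orthogonal_def)
    have wv': "v j \<bullet> (S *v w) = 0" if "j \<in> J" for j
      using wv[OF that] spd_inner_commute[OF assms] by metis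
    define s where "s = w \<bullet> (S *v w)"
    have "0 < s" using spd_pos[OF assms \<open>w \<noteq> 0\<close>] by (simp add: s_def)
    let ?v = "v(k := (1 / sqrt s) *\<^sub>R w)"
    have "1 / sqrt s * (1 / sqrt s * s) = 1" using \<open>0 < s\<close> by (simp add: field_simps)
    then have "\<forall>i\<in>insert k J. \<forall>j\<in>insert k J. ?v i \<bullet> (S *v ?v j) = (if i = j then 1 else 0)"
      using \<open>k \<notin> J\<close> v wv wv'
      by (auto simp: matrix_vector_mult_scaleR s_def[symmetric])
    then show ?case by blast
  qed simp
  from this[of UNIV] obtain v :: "'k \<Rightarrow> real^'k"
    where v: "\<And>i j. v i \<bullet> (S *v v j) = (if i = j then 1 else 0)" by auto
  define T where "T = (\<chi> a b. v b $ a)"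
  have "(transpose T ** S ** T) $ i $ j = v i \<bullet> (S *v v j)" for i j
    unfolding matrix_mul_assoc[symmetric]
    by (simp add: T_def matrix_matrix_mult_def matrix_vector_mult_def transpose_def inner_vec_def)
  then have "transpose T ** S ** T = mat 1"
    by (simp add: vec_eq_iff v mat_def)
  then show ?thesis by (rule that)
qed

lemma spd_det_pos:
  fixes S :: "real^'k^'k"
  assumes "S \<in> spd" shows "0 < det S"
proof -
  obtain T :: "real^'k^'k" where T: "transpose T ** S ** T = mat 1" by (rule spd_congruent_mat_1[OF assms])
  have "det T * det S * det T = 1"
    using arg_cong[OF T, of det] by (simp add: det_mul)
  then have "(det T)\<^sup>2 * det S = 1" by (simp add: power2_eq_square algebra_simps)
  then show ?thesis by (metis zero_less_one zero_less_mult_pos zero_less_power2 mult_zero_left power_zero_numeral zero_neq_one)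
qed

lemma det_matrix_inv: "S \<in> spd \<Longrightarrow> det (matrix_inv S) = 1 / det (S :: real^'k^'k)"
  using arg_cong[OF spd_inv_right[of S], of det] spd_det_pos[of S] by (simp add: det_mul field_simps)

section \<open>Gaussian measures\<close>

lemma matrix_mult_measurable [measurable]:
  "(*v) T \<in> borel_measurable borel" for T :: "real^'k^'m"
  by (intro borel_measurable_continuous_onI linear_continuous_on)
    (simp add: linear_conv_bounded_linear[symmetric])

lemma gaussian_density_measurable [measurable]: "gaussian_density C \<in> borel_measurable borel"
  unfolding gaussian_density_def[abs_def] by measurable

lemma gaussian_density_pos: "C \<in> spd \<Longrightarrow> 0 < gaussian_density C x"
  unfolding gaussian_density_def by (intro divide_pos_pos) (auto simp: spd_det_pos)

lemma sets_gaussian [simp, measurable_cong]: "sets (gaussian C) = sets borel"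
  by (simp add: gaussian_def)

lemma space_gaussian [simp]: "space (gaussian C) = UNIV"
  by (simp add: gaussian_def)

text \<open>Such a \<open>T\<close> satisfies \<open>T T\<^sup>T = C\<close> and \<open>\<bar>det T\<bar> = sqrt (det C)\<close>, so the Jacobian of the substitution
turns the normalising constant of \<open>C\<close> into that of the identity. With \<open>C = I\<close> the lemma also says
that the standard Gaussian is invariant under orthogonal maps.\<close>

lemma gaussian_linear_image:
  fixes C T :: "real^'k^'k"
  assumes C: "C \<in> spd" and T: "transpose T ** matrix_inv C ** T = mat 1"
  shows "gaussian C = distr (gaussian (mat 1)) borel ((*v) T)"
proof (rule measure_eqI)
  fix X assume "X \<in> sets (gaussian C)"
  then have [measurable]: "X \<in> sets borel" by simp
  have [measurable]: "(*v) T -` X \<in> sets borel"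
    using measurable_sets[OF matrix_mult_measurable, of X T] by simp
  have "det T * det (matrix_inv C) * det T = 1"
    using arg_cong[OF T, of det] by (simp add: det_mul)
  then have "det T * det T = det C"
    using spd_det_pos[OF C] by (simp add: det_matrix_inv[OF C] field_simps)
  then have detT: "\<bar>det T\<bar> = sqrt (det C)" and nz: "det T \<noteq> 0"
    using spd_det_pos[OF C] real_sqrt_abs2[of "det T"] by auto
  have quad: "(T *v u) \<bullet> (matrix_inv C *v (T *v u)) = u \<bullet> u" for u
  proof -
    have "(T *v u) \<bullet> (matrix_inv C *v (T *v u)) = u \<bullet> ((transpose T ** matrix_inv C ** T) *v u)"
      by (simp add: matrix_vector_mul_assoc[symmetric] inner_matrix_vector_swap[of u] del: transpose_matrix_vector)
    then show ?thesis by (simp add: T)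
  qed
  have inv1: "matrix_inv (mat 1) = (mat 1 :: real^'k^'k)" by (rule matrix_inv_unique) simp
  have dens: "\<bar>det T\<bar> * gaussian_density C (T *v u) = gaussian_density (mat 1) u" for u
    using spd_det_pos[OF C]
    by (simp add: gaussian_density_def quad detT inv1 real_sqrt_mult)
  have "emeasure (gaussian C) X = (\<integral>\<^sup>+x. ennreal (gaussian_density C x) * indicator X x \<partial>lborel)"
    by (simp add: gaussian_def emeasure_density)
  also have "\<dots> = ennreal \<bar>det T\<bar> *
      (\<integral>\<^sup>+u. ennreal (gaussian_density C (T *v u)) * indicator X (T *v u) \<partial>lborel)"
    using nz by (subst nn_integral_linear_change_of_variables[of "(*v) T"]) simp_all
  also have "\<dots> = (\<integral>\<^sup>+u. ennreal (gaussian_density (mat 1) u) * indicator X (T *v u) \<partial>lborel)"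
    by (subst nn_integral_cmult[symmetric])
      (auto simp: dens[symmetric] ennreal_mult mult.assoc gaussian_density_pos[OF C] less_imp_le)
  also have "\<dots> = emeasure (distr (gaussian (mat 1)) borel ((*v) T)) X"
    by (simp add: emeasure_distr gaussian_def emeasure_density indicator_def of_bool_def vimage_def)
  finally show "emeasure (gaussian C) X = emeasure (distr (gaussian (mat 1)) borel ((*v) T)) X" .
qed simp

lemma gaussian_density_mat_1:
  "gaussian_density (mat 1) (x :: real^'k) = (\<Prod>b\<in>Basis. std_normal_density (x \<bullet> b))"
proof -
  have inv1: "matrix_inv (mat 1) = (mat 1 :: real^'k^'k)" by (rule matrix_inv_unique) simp
  have "(\<Prod>b\<in>(Basis :: (real^'k) set). std_normal_density (x \<bullet> b)) =
      exp (\<Sum>b\<in>(Basis :: (real^'k) set). - (x \<bullet> b)\<^sup>2 / 2) / sqrt (2 * pi) ^ DIM(real^'k)"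
    by (simp add: normal_density_def exp_sum prod_dividef del: DIM_cart)
  also have "(\<Sum>b\<in>(Basis :: (real^'k) set). - (x \<bullet> b)\<^sup>2 / 2) = - (x \<bullet> x) / 2"
    by (simp add: euclidean_inner[of x x] power2_eq_square sum_negf sum_divide_distrib)
  finally show ?thesis
    by (simp add: gaussian_density_def inv1 real_sqrt_power real_sqrt_mult power_mult_distrib)
qed

lemma nn_integral_std_normal_density: "(\<integral>\<^sup>+t. ennreal (std_normal_density t) \<partial>lborel) = 1"
  by (subst nn_integral_eq_integral) (auto simp: normal_density_nonneg)

lemma prob_space_gaussian_mat_1: "prob_space (gaussian (mat 1 :: real^'k^'k))"
proof
  have "emeasure (gaussian (mat 1 :: real^'k^'k)) (space (gaussian (mat 1 :: real^'k^'k))) =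
      (\<integral>\<^sup>+x. (\<Prod>b\<in>(Basis :: (real^'k) set). ennreal (std_normal_density (x \<bullet> b))) \<partial>lborel)"
    by (simp add: gaussian_def emeasure_density gaussian_density_mat_1 prod_ennreal normal_density_nonneg)
  also have "\<dots> = 1"
    by (subst nn_integral_lborel_prod) (simp_all add: nn_integral_std_normal_density)
  finally show "emeasure (gaussian (mat 1 :: real^'k^'k)) (space (gaussian (mat 1 :: real^'k^'k))) = 1" .
qed

lemma gaussian_mat_1_second_moment_diag:
  "integrable (gaussian (mat 1)) (\<lambda>u :: real^'k. (u $ i)\<^sup>2)"
  "(\<integral>u. (u $ i)\<^sup>2 \<partial>gaussian (mat 1 :: real^'k^'k)) = 1"
proof -
  let ?f = "\<lambda>b t. ennreal (std_normal_density t * (if b = axis i 1 then t\<^sup>2 else 1))"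
  have "(\<integral>\<^sup>+u. ennreal ((u $ i)\<^sup>2) \<partial>gaussian (mat 1 :: real^'k^'k)) =
      (\<integral>\<^sup>+u. (\<Prod>b\<in>(Basis :: (real^'k) set). ?f b (u \<bullet> b)) \<partial>lborel)"
    unfolding gaussian_def
  proof (subst nn_integral_density)
    have "(\<Prod>b\<in>Basis. if b = axis i 1 then (x \<bullet> b)\<^sup>2 else 1) = (x $ i)\<^sup>2" for x :: "real^'k"
      by (subst prod.delta) (auto simp: inner_axis)
    then have "ennreal (gaussian_density (mat 1) x) * ennreal ((x $ i)\<^sup>2) = (\<Prod>b\<in>Basis. ?f b (x \<bullet> b))" for x
      by (subst prod_ennreal)
        (auto simp: gaussian_density_mat_1 prod.distrib ennreal_mult'' normal_density_nonneg)
    then show "(\<integral>\<^sup>+x. ennreal (gaussian_density (mat 1) x) * ennreal ((x $ i)\<^sup>2) \<partial>lborel) =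
        (\<integral>\<^sup>+u. (\<Prod>b\<in>(Basis :: (real^'k) set). ?f b (u \<bullet> b)) \<partial>lborel)" by simp
  qed auto
  also have "\<dots> = (\<Prod>b\<in>(Basis :: (real^'k) set). \<integral>\<^sup>+t. ?f b t \<partial>lborel)"
    by (rule nn_integral_lborel_prod) (auto simp: normal_density_nonneg)
  also have "\<dots> = 1"
  proof (rule prod.neutral, safe)
    fix b :: "real^'k"
    have "(\<integral>\<^sup>+t. ennreal (std_normal_density t * t\<^sup>2) \<partial>lborel) = 1"
      using std_normal_moment_even[of 1]
      by (subst nn_integral_eq_integral)
        (auto simp: normal_density_nonneg has_bochner_integral_iff fact_numeral)
    then show "(\<integral>\<^sup>+t. ?f b t \<partial>lborel) = 1"
      using nn_integral_std_normal_density by (cases "b = axis i 1") simp_all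
  qed
  finally have *: "(\<integral>\<^sup>+u. ennreal ((u $ i)\<^sup>2) \<partial>gaussian (mat 1 :: real^'k^'k)) = ennreal 1" by simp
  then have "has_bochner_integral (gaussian (mat 1 :: real^'k^'k)) (\<lambda>u. (u $ i)\<^sup>2) 1"
    by (intro has_bochner_integral_nn_integral) auto
  then show "integrable (gaussian (mat 1)) (\<lambda>u :: real^'k. (u $ i)\<^sup>2)"
    "(\<integral>u. (u $ i)\<^sup>2 \<partial>gaussian (mat 1 :: real^'k^'k)) = 1"
    by (simp_all add: has_bochner_integral_iff)
qed

text \<open>The mixed moments vanish by symmetry: reflecting one coordinate preserves the measure and changes
the sign of the integrand.\<close>

lemma gaussian_mat_1_second_moment:
  shows "integrable (gaussian (mat 1)) (\<lambda>u :: real^'k. u $ i * u $ j)"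
    and "(\<integral>u. u $ i * u $ j \<partial>gaussian (mat 1 :: real^'k^'k)) = (if i = j then 1 else 0)"
proof -
  show int: "integrable (gaussian (mat 1)) (\<lambda>u :: real^'k. u $ i * u $ j)"
  proof (rule Bochner_Integration.integrable_bound)
    show "integrable (gaussian (mat 1)) (\<lambda>u :: real^'k. (u $ i)\<^sup>2 + (u $ j)\<^sup>2)"
      by (intro Bochner_Integration.integrable_add gaussian_mat_1_second_moment_diag)
    have "\<bar>a * b\<bar> \<le> a\<^sup>2 + b\<^sup>2" for a b :: real
    proof -
      have "2 * (\<bar>a\<bar> * \<bar>b\<bar>) \<le> a\<^sup>2 + b\<^sup>2" and "0 \<le> \<bar>a\<bar> * \<bar>b\<bar>"
        using sum_squares_bound[of "\<bar>a\<bar>" "\<bar>b\<bar>"] by simp_all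
      then show ?thesis unfolding abs_mult by linarith
    qed
    then show "AE u in gaussian (mat 1). norm ((u :: real^'k) $ i * u $ j) \<le> norm ((u $ i)\<^sup>2 + (u $ j)\<^sup>2)"
      by (auto intro: order_trans)
  qed simp
  show "(\<integral>u. u $ i * u $ j \<partial>gaussian (mat 1 :: real^'k^'k)) = (if i = j then 1 else 0)"
  proof (cases "i = j")
    case True
    then show ?thesis using gaussian_mat_1_second_moment_diag(2)[of i] by (simp add: power2_eq_square)
  next
    case False
    define T :: "real^'k^'k" where "T = (\<chi> a. (if a = i then - 1 else 1) *\<^sub>R axis a 1)"
    have Tu: "T *v u = (\<chi> a. if a = i then - u $ i else u $ a)" for u
      by (simp add: vec_eq_iff T_def matrix_mult_dot inner_axis')
    have "transpose T = T" by (auto simp: T_def transpose_def vec_eq_iff axis_def)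
    moreover have "T ** T = mat 1"
      by (simp add: matrix_eq matrix_vector_mul_assoc[symmetric] Tu vec_eq_iff)
    moreover have "matrix_inv (mat 1) = (mat 1 :: real^'k^'k)" by (rule matrix_inv_unique) simp
    ultimately have "gaussian (mat 1) = distr (gaussian (mat 1)) borel ((*v) T)"
      by (intro gaussian_linear_image spd_mat_1) simp
    then have "(\<integral>u. u $ i * u $ j \<partial>gaussian (mat 1 :: real^'k^'k)) =
        (\<integral>u. u $ i * u $ j \<partial>distr (gaussian (mat 1)) borel ((*v) T))"
      by (rule arg_cong)
    also have "\<dots> = (\<integral>u. - (u $ i * u $ j) \<partial>gaussian (mat 1 :: real^'k^'k))"
      using False by (subst integral_distr) (auto simp: Tu)
    finally show ?thesis using False by simp
  qed
qed

lemma quadratic_form_sum: "x \<bullet> (Q *v x) = (\<Sum>i\<in>UNIV. \<Sum>j\<in>UNIV. Q $ i $ j * (x $ i * x $ j))"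
  for x :: "real^'k"
  by (simp add: inner_vec_def matrix_vector_mult_def sum_distrib_left mult_ac)

lemma gaussian_mat_1_quadratic_form:
  fixes N :: "real^'k^'k"
  shows "integrable (gaussian (mat 1)) (\<lambda>u. u \<bullet> (N *v u))"
    and "(\<integral>u. u \<bullet> (N *v u) \<partial>gaussian (mat 1)) = trace N"
  unfolding quadratic_form_sum
  by (auto simp: gaussian_mat_1_second_moment trace_def if_distrib cong: if_cong
      intro!: Bochner_Integration.integrable_sum)

lemma gaussian_standardize:
  fixes C :: "real^'k^'k"
  assumes C: "C \<in> spd"
  obtains T :: "real^'k^'k" where "gaussian C = distr (gaussian (mat 1)) borel ((*v) T)" and "T ** transpose T = C"
proof -
  obtain T :: "real^'k^'k" where T: "transpose T ** matrix_inv C ** T = mat 1"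
    by (rule spd_congruent_mat_1[OF spd_matrix_inv[OF C]])
  then have "T ** (transpose T ** matrix_inv C) = mat 1"
    by (simp add: matrix_left_right_inverse)
  then have "T ** transpose T ** matrix_inv C ** C = C"
    by (simp add: matrix_mul_assoc)
  then have "T ** transpose T = C"
    by (simp add: matrix_mul_assoc[symmetric] spd_inv_left[OF C])
  then show ?thesis using that gaussian_linear_image[OF C T] by blast
qed

lemma prob_space_gaussian:
  fixes C :: "real^'k^'k"
  assumes "C \<in> spd" shows "prob_space (gaussian C)"
proof -
  obtain T :: "real^'k^'k" where T: "gaussian C = distr (gaussian (mat 1)) borel ((*v) T)"
    by (rule gaussian_standardize[OF assms])
  show ?thesis unfolding T
    by (rule prob_space.prob_space_distr[OF prob_space_gaussian_mat_1]) simp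
qed

lemma gaussian_quadratic_form:
  fixes C Q :: "real^'k^'k"
  assumes "C \<in> spd"
  shows "integrable (gaussian C) (\<lambda>x. x \<bullet> (Q *v x))"
    and "(\<integral>x. x \<bullet> (Q *v x) \<partial>gaussian C) = hs_inner Q C"
proof -
  obtain T :: "real^'k^'k" where T: "gaussian C = distr (gaussian (mat 1)) borel ((*v) T)" and TT: "T ** transpose T = C"
    by (rule gaussian_standardize[OF assms])
  have [measurable]: "(\<lambda>x. x \<bullet> (Q *v x)) \<in> borel_measurable borel" by measurable
  have quad: "(T *v u) \<bullet> (Q *v (T *v u)) = u \<bullet> ((transpose T ** Q ** T) *v u)" for u
    by (simp add: matrix_vector_mul_assoc[symmetric] inner_matrix_vector_swap[of u] del: transpose_matrix_vector)
  show "integrable (gaussian C) (\<lambda>x. x \<bullet> (Q *v x))"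
    unfolding T by (subst integrable_distr_eq) (simp_all add: quad gaussian_mat_1_quadratic_form)
  have "(\<integral>x. x \<bullet> (Q *v x) \<partial>gaussian C) = trace (transpose T ** Q ** T)"
    unfolding T by (subst integral_distr) (simp_all add: quad gaussian_mat_1_quadratic_form)
  also have "\<dots> = trace (Q ** (T ** transpose T))"
    by (metis trace_mul_sym matrix_mul_assoc)
  finally show "(\<integral>x. x \<bullet> (Q *v x) \<partial>gaussian C) = hs_inner Q C"
    by (simp add: hs_inner_def TT spd_sym[OF assms])
qed

section \<open>Gaussians on a product space and their marginals\<close>

lemma stack_nth [simp]: "stack x y $ Inl i = x $ i" "stack x y $ Inr i = y $ i"
  by (simp_all add: stack_def)

lemma vec_sum_eq_iff: "v = w \<longleftrightarrow> (\<forall>i. v $ Inl i = w $ Inl i) \<and> (\<forall>i. v $ Inr i = w $ Inr i)"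
  for v w :: "'a^('n::finite + 'm::finite)"
  by (metis vec_eq_iff obj_sumE)

lemma all_sum_iff: "(\<forall>k. P k) \<longleftrightarrow> (\<forall>i. P (Inl i)) \<and> (\<forall>i. P (Inr i))"
  by (metis obj_sumE)

lemma sum_UNIV_sum: "(\<Sum>k\<in>UNIV. f k) = (\<Sum>i\<in>UNIV. f (Inl i)) + (\<Sum>i\<in>UNIV. f (Inr i))"
  for f :: "'n::finite + 'm::finite \<Rightarrow> 'a::comm_monoid_add"
  by (subst UNIV_Plus_UNIV[symmetric], subst sum.Plus) simp_all

lemma prod_UNIV_sum: "(\<Prod>k\<in>UNIV. f k) = (\<Prod>i\<in>UNIV. f (Inl i)) * (\<Prod>i\<in>UNIV. f (Inr i))"
  for f :: "'n::finite + 'm::finite \<Rightarrow> 'a::comm_monoid_mult"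
  by (subst UNIV_Plus_UNIV[symmetric], subst prod.Plus) simp_all

lemma stack_cases:
  obtains x y where "z = stack x y"
proof
  show "z = stack (\<chi> i. z $ Inl i) (\<chi> i. z $ Inr i)" by (simp add: vec_sum_eq_iff)
qed

lemma stack_inner: "stack x y \<bullet> stack x' y' = x \<bullet> x' + y \<bullet> y'"
  by (simp add: inner_vec_def sum_UNIV_sum)

lemma stack_add: "stack x y + stack x' y' = stack (x + x') (y + y')"
  by (simp add: vec_sum_eq_iff)

lemma stack_eq_0_iff: "stack x y = 0 \<longleftrightarrow> x = 0 \<and> y = 0"
  by (simp add: vec_sum_eq_iff vec_eq_iff[of x] vec_eq_iff[of y])

lemma fst_snd_borel_measurable [measurable]:
  "(fst :: 'a::topological_space \<times> 'b::topological_space \<Rightarrow> 'a) \<in> borel_measurable borel"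
  "(snd :: 'a::topological_space \<times> 'b::topological_space \<Rightarrow> 'b) \<in> borel_measurable borel"
  by (intro borel_measurable_continuous_onI continuous_intros)+

lemma measurable_stack [measurable (raw)]:
  assumes "f \<in> borel_measurable M" and "g \<in> borel_measurable M"
  shows "(\<lambda>z. stack (f z) (g z)) \<in> borel_measurable M"
proof (rule borel_measurable_continuous_Pair[OF assms])
  have "linear (\<lambda>z. stack (fst z) (snd z))"
    by (rule linearI) (simp_all add: vec_sum_eq_iff)
  from linear_continuous_on[OF this[unfolded linear_conv_bounded_linear]]
  show "continuous_on UNIV (\<lambda>z. stack (fst z) (snd z))" .
qed

text \<open>Integrals over pairs become integrals over \<open>2d\<close> coordinates, so that the normalisation of the
Gaussian on the stacked space carries over to the product.\<close>

lemma lborel_stack: "(lborel :: (real^('n::finite + 'n)) measure) = distr lborel borel (\<lambda>(x, y). stack x y)"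
proof (rule lborel_eqI)
  fix l u :: "real^('n + 'n)"
  assume le: "\<And>b. b \<in> Basis \<Longrightarrow> l \<bullet> b \<le> u \<bullet> b"
  obtain l1 l2 where l: "l = stack l1 l2" by (rule stack_cases)
  obtain u1 u2 where u: "u = stack u1 u2" by (rule stack_cases)
  have le1: "l1 $ i \<le> u1 $ i" and le2: "l2 $ i \<le> u2 $ i" for i
    using le[of "axis (Inl i) 1"] le[of "axis (Inr i) 1"] by (simp_all add: l u inner_axis)
  have "(\<lambda>(x, y). stack x y) -` box l u = box l1 u1 \<times> box l2 u2"
    by (auto simp: l u mem_box_cart all_sum_iff)
  then have "emeasure (distr lborel borel (\<lambda>(x, y). stack x y)) (box l u) =
      emeasure (lborel \<Otimes>\<^sub>M lborel) (box l1 u1 \<times> box l2 u2)"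
    by (subst emeasure_distr) (simp_all add: lborel_prod)
  also have "\<dots> = emeasure lborel (box l1 u1) * emeasure lborel (box l2 u2)"
    by (rule lborel.emeasure_pair_measure_Times) simp_all
  also have "\<dots> = ennreal (\<Prod>i\<in>UNIV. u1 $ i - l1 $ i) * ennreal (\<Prod>i\<in>UNIV. u2 $ i - l2 $ i)"
    using le1 le2 by (simp add: emeasure_lborel_box_eq Basis_cart inner_axis prod_Basis_cart[unfolded Basis_cart])
  also have "\<dots> = (\<Prod>b\<in>Basis. (u - l) \<bullet> b)"
    using le1 le2
    by (simp add: prod_Basis_cart prod_UNIV_sum l u inner_axis ennreal_mult prod_nonneg)
  finally show "emeasure (distr lborel borel (\<lambda>(x, y). stack x y)) (box l u) = (\<Prod>b\<in>Basis. (u - l) \<bullet> b)" .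
qed simp

lemma sets_gaussian_prod [simp, measurable_cong]: "sets (gaussian_prod S) = sets borel"
  by (simp add: gaussian_prod_def)

lemma nn_integral_gaussian_prod_density:
  assumes "S \<in> spd"
  shows "(\<integral>\<^sup>+z. ennreal (case z of (x, y) \<Rightarrow> gaussian_density S (stack x y)) \<partial>lborel) = 1"
proof -
  interpret prob_space "gaussian S" by (rule prob_space_gaussian[OF assms])
  have "1 = (\<integral>\<^sup>+z. ennreal (gaussian_density S z) \<partial>lborel)"
    using emeasure_space_1 by (simp add: gaussian_def emeasure_density)
  also have "\<dots> = (\<integral>\<^sup>+z. ennreal (case z of (x, y) \<Rightarrow> gaussian_density S (stack x y)) \<partial>lborel)"
    by (subst lborel_stack) (subst nn_integral_distr; simp add: case_prod_unfold)
  finally show ?thesis ..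
qed

lemma prob_space_gaussian_prod: "S \<in> spd \<Longrightarrow> prob_space (gaussian_prod S)"
  by (intro prob_spaceI, unfold gaussian_prod_def, subst emeasure_density)
    (use nn_integral_gaussian_prod_density[of S] in \<open>simp_all add: case_prod_unfold\<close>)

text \<open>It suffices to know the marginal density up to a constant factor \<open>\<kappa>\<close>, because both densities
have total mass 1. For Gaussians \<open>\<kappa>\<close> is a quotient of determinants; the total mass determines it.\<close>

lemma distr_fst_density:
  fixes f :: "'a::euclidean_space \<times> 'b::euclidean_space \<Rightarrow> ennreal"
  assumes [measurable]: "f \<in> borel_measurable borel" "g \<in> borel_measurable borel"
    and fibre: "\<And>x. (\<integral>\<^sup>+y. f (x, y) \<partial>lborel) = g x * \<kappa>"
    and "(\<integral>\<^sup>+z. f z \<partial>lborel) = 1" and "(\<integral>\<^sup>+x. g x \<partial>lborel) = 1"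
  shows "distr (density lborel f) borel fst = density lborel g"
proof -
  have fubini: "(\<integral>\<^sup>+z. h (fst z) * f z \<partial>lborel) = (\<integral>\<^sup>+x. h x * g x \<partial>lborel) * \<kappa>"
    if [measurable]: "h \<in> borel_measurable borel" for h
  proof -
    have [measurable]: "f \<in> borel_measurable (borel \<Otimes>\<^sub>M borel)"
      using assms(1) by (simp add: borel_prod)
    show ?thesis
      unfolding lborel_prod[symmetric]
      by (subst lborel.nn_integral_fst[symmetric])
        (simp_all add: nn_integral_cmult fibre mult.assoc[symmetric] nn_integral_multc)
  qed
  have "\<kappa> = 1" using fubini[of "\<lambda>_. 1"] assms by simp
  show ?thesis
  proof (rule measure_eqI)
    fix X assume "X \<in> sets (distr (density lborel f) borel fst)"
    then have [measurable]: "X \<in> sets borel" by simp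
    have [measurable]: "fst -` X \<in> sets (borel :: ('a \<times> 'b) measure)"
      using measurable_sets[of fst "borel :: ('a \<times> 'b) measure" borel X] by simp
    show "emeasure (distr (density lborel f) borel fst) X = emeasure (density lborel g) X"
      using fubini[of "indicator X"]
      by (simp add: emeasure_distr emeasure_density \<open>\<kappa> = 1\<close> mult.commute indicator_vimage)
  qed simp
qed

lemma distr_snd_density:
  fixes f :: "'a::euclidean_space \<times> 'b::euclidean_space \<Rightarrow> ennreal"
  assumes [measurable]: "f \<in> borel_measurable borel" "g \<in> borel_measurable borel"
    and fibre: "\<And>y. (\<integral>\<^sup>+x. f (x, y) \<partial>lborel) = g y * \<kappa>"
    and "(\<integral>\<^sup>+z. f z \<partial>lborel) = 1" and "(\<integral>\<^sup>+y. g y \<partial>lborel) = 1"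
  shows "distr (density lborel f) borel snd = density lborel g"
proof -
  have fubini: "(\<integral>\<^sup>+z. h (snd z) * f z \<partial>lborel) = (\<integral>\<^sup>+y. h y * g y \<partial>lborel) * \<kappa>"
    if [measurable]: "h \<in> borel_measurable borel" for h
  proof -
    have [measurable]: "f \<in> borel_measurable (borel \<Otimes>\<^sub>M borel)"
      using assms(1) by (simp add: borel_prod)
    show ?thesis
      unfolding lborel_prod[symmetric]
      by (subst lborel_pair.nn_integral_snd[symmetric])
        (simp_all add: nn_integral_cmult fibre mult.assoc[symmetric] nn_integral_multc)
  qed
  have "\<kappa> = 1" using fubini[of "\<lambda>_. 1"] assms by simp
  show ?thesis
  proof (rule measure_eqI)
    fix X assume "X \<in> sets (distr (density lborel f) borel snd)"
    then have [measurable]: "X \<in> sets borel" by simp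
    have [measurable]: "snd -` X \<in> sets (borel :: ('a \<times> 'b) measure)"
      using measurable_sets[of snd "borel :: ('a \<times> 'b) measure" borel X] by simp
    show "emeasure (distr (density lborel f) borel snd) X = emeasure (density lborel g) X"
      using fubini[of "indicator X"]
      by (simp add: emeasure_distr emeasure_density \<open>\<kappa> = 1\<close> mult.commute indicator_vimage)
  qed simp
qed

text \<open>Since \<open>S\<^sup>-\<^sup>1 (S w) = w\<close>, the vectors \<open>r\<close> and \<open>S w\<close> are orthogonal for the form
\<open>S\<^sup>-\<^sup>1\<close> if \<open>r\<close> and \<open>w\<close> are orthogonal. If \<open>w\<close> is supported on one block of coordinates, \<open>r\<close> may be
any vector supported on the other.\<close>

lemma spd_complete_square:
  fixes S :: "real^'k^'k"
  assumes "S \<in> spd" and "r \<bullet> w = 0"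
  shows "(S *v w + r) \<bullet> (matrix_inv S *v (S *v w + r)) = w \<bullet> (S *v w) + r \<bullet> (matrix_inv S *v r)"
proof -
  have "matrix_inv S *v (S *v w + r) = w + matrix_inv S *v r"
    by (simp add: matrix_vector_right_distrib matrix_vector_mul_assoc spd_inv_left[OF assms(1)])
  moreover have "(S *v w) \<bullet> (matrix_inv S *v r) = r \<bullet> w"
    using spd_inner_commute[OF spd_matrix_inv[OF assms(1)], of "S *v w" r]
    by (simp add: matrix_vector_mul_assoc spd_inv_left[OF assms(1)])
  ultimately show ?thesis
    using assms(2) by (simp add: inner_add_left inner_add_right inner_commute)
qed

lemma mult_stack_0_Inl: "(S *v stack v 0) $ Inl i = (block11 S *v v) $ i"
  by (simp add: matrix_vector_mult_def sum_UNIV_sum block11_def)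

lemma mult_0_stack_Inr: "(S *v stack 0 v) $ Inr i = (block22 S *v v) $ i"
  by (simp add: matrix_vector_mult_def sum_UNIV_sum block22_def)

lemma inner_stack_left: "stack x y \<bullet> z = x \<bullet> (\<chi> i. z $ Inl i) + y \<bullet> (\<chi> i. z $ Inr i)"
  by (simp add: inner_vec_def sum_UNIV_sum)

lemma block11_quadratic_form: "stack v 0 \<bullet> (S *v stack v 0) = v \<bullet> (block11 S *v v)"
  by (simp add: inner_stack_left mult_stack_0_Inl)

lemma block22_quadratic_form: "stack 0 v \<bullet> (S *v stack 0 v) = v \<bullet> (block22 S *v v)"
  by (simp add: inner_stack_left mult_0_stack_Inr)

lemma spd_block11: "S \<in> spd \<Longrightarrow> block11 S \<in> spd"
  unfolding spd_def
  by (auto simp: block11_quadratic_form[symmetric] stack_eq_0_iff)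
    (simp add: block11_def transpose_def vec_eq_iff)

lemma spd_block22: "S \<in> spd \<Longrightarrow> block22 S \<in> spd"
  unfolding spd_def
  by (auto simp: block22_quadratic_form[symmetric] stack_eq_0_iff)
    (simp add: block22_def transpose_def vec_eq_iff)

lemma gaussian_density_complete_square:
  fixes S :: "real^'k^'k" and A :: "real^'n^'n"
  assumes "S \<in> spd" and "A \<in> spd" and "r \<bullet> w = 0" and "w \<bullet> (S *v w) = x \<bullet> (matrix_inv A *v x)"
  shows "gaussian_density S (S *v w + r) = gaussian_density A x *
    (sqrt ((2 * pi) ^ CARD('n) * det A) * gaussian_density S r)"
  using spd_det_pos[OF assms(2)] assms(3,4)
  by (simp add: gaussian_density_def spd_complete_square[OF assms(1)] exp_add[symmetric] diff_divide_distrib)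

text \<open>For the first marginal, \<open>w = (A\<^sup>-\<^sup>1 x, 0)\<close> is chosen so that \<open>S w = (x, l)\<close> for some \<open>l\<close>. Completing
the square writes the density at \<open>(x, y)\<close> as the density of \<open>N(A)\<close> at \<open>x\<close> times a function of
\<open>y - l\<close>, whose integral over \<open>y\<close> does not depend on \<open>x\<close>. The second marginal is symmetric.\<close>

lemma gaussian_prod_marginals:
  fixes S :: "real^('n::finite + 'n)^('n + 'n)"
  assumes S: "S \<in> spd"
  shows "distr (gaussian_prod S) borel fst = gaussian (block11 S)"
    and "distr (gaussian_prod S) borel snd = gaussian (block22 S)"
proof -
  let ?f = "\<lambda>z. ennreal (case z of (x, y) \<Rightarrow> gaussian_density S (stack x y))"
  have [measurable]: "?f \<in> borel_measurable borel" by measurable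
  have f: "gaussian_prod S = density lborel ?f"
    by (simp add: gaussian_prod_def case_prod_unfold)
  have int_f: "(\<integral>\<^sup>+z. ?f z \<partial>lborel) = 1" by (rule nn_integral_gaussian_prod_density[OF S])
  have int_g: "(\<integral>\<^sup>+x. ennreal (gaussian_density A x) \<partial>lborel) = 1" if "A \<in> spd" for A :: "real^'n^'n"
    using prob_space.emeasure_space_1[OF prob_space_gaussian[OF that]]
    by (simp add: gaussian_def emeasure_density)
  define A where "A = block11 S"
  have A: "A \<in> spd" unfolding A_def by (rule spd_block11[OF S])
  define \<rho>1 where "\<rho>1 r = sqrt ((2 * pi) ^ CARD('n) * det A) * gaussian_density S (stack 0 r)" for r
  have [measurable]: "\<rho>1 \<in> borel_measurable borel" unfolding \<rho>1_def[abs_def] by measurable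
  have fibre1: "(\<integral>\<^sup>+y. ?f (x, y) \<partial>lborel) = ennreal (gaussian_density A x) * (\<integral>\<^sup>+y. ennreal (\<rho>1 y) \<partial>lborel)" for x
  proof -
    let ?w = "stack (matrix_inv A *v x) 0"
    define l where "l = (\<chi> i. (S *v ?w) $ Inr i)"
    have Sw: "S *v ?w = stack x l"
      by (simp add: l_def vec_sum_eq_iff mult_stack_0_Inl A_def[symmetric] matrix_vector_mul_assoc spd_inv_right[OF A])
    have "gaussian_density S (stack x y) = gaussian_density A x * \<rho>1 (y + (- l))" for y
    proof -
      have *: "stack x y = S *v ?w + stack 0 (y + (- l))" by (simp add: Sw stack_add)
      show ?thesis unfolding * \<rho>1_def
        by (rule gaussian_density_complete_square[OF S A])
          (simp_all add: stack_inner Sw inner_commute)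
    qed
    then have "(\<integral>\<^sup>+y. ?f (x, y) \<partial>lborel) =
        (\<integral>\<^sup>+y. ennreal (gaussian_density A x) * ennreal (\<rho>1 (y + (- l))) \<partial>lborel)"
      by (simp only: ennreal_mult'[OF less_imp_le[OF gaussian_density_pos[OF A]]] prod.case)
    also have "\<dots> = ennreal (gaussian_density A x) * (\<integral>\<^sup>+y. ennreal (\<rho>1 (y + (- l))) \<partial>lborel)"
      by (rule nn_integral_cmult) measurable
    also have "(\<integral>\<^sup>+y. ennreal (\<rho>1 (y + (- l))) \<partial>lborel) = (\<integral>\<^sup>+y. ennreal (\<rho>1 y) \<partial>lborel)"
      by (rule nn_integral_lborel_shift[where g="\<lambda>y. ennreal (\<rho>1 y)"]) measurable
    finally show ?thesis .
  qed
  show "distr (gaussian_prod S) borel fst = gaussian (block11 S)"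
    unfolding f gaussian_def A_def[symmetric]
    by (rule distr_fst_density[OF _ _ fibre1 int_f int_g[OF A]]) simp_all
  define B where "B = block22 S"
  have B: "B \<in> spd" unfolding B_def by (rule spd_block22[OF S])
  define \<rho>2 where "\<rho>2 r = sqrt ((2 * pi) ^ CARD('n) * det B) * gaussian_density S (stack r 0)" for r
  have [measurable]: "\<rho>2 \<in> borel_measurable borel" unfolding \<rho>2_def[abs_def] by measurable
  have fibre2: "(\<integral>\<^sup>+x. ?f (x, y) \<partial>lborel) = ennreal (gaussian_density B y) * (\<integral>\<^sup>+y. ennreal (\<rho>2 y) \<partial>lborel)" for y
  proof -
    let ?w = "stack 0 (matrix_inv B *v y)"
    define l where "l = (\<chi> i. (S *v ?w) $ Inl i)"
    have Sw: "S *v ?w = stack l y"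
      by (simp add: l_def vec_sum_eq_iff mult_0_stack_Inr B_def[symmetric] matrix_vector_mul_assoc spd_inv_right[OF B])
    have "gaussian_density S (stack x y) = gaussian_density B y * \<rho>2 (x + (- l))" for x
    proof -
      have *: "stack x y = S *v ?w + stack (x + (- l)) 0" by (simp add: Sw stack_add)
      show ?thesis unfolding * \<rho>2_def
        by (rule gaussian_density_complete_square[OF S B])
          (simp_all add: stack_inner Sw inner_commute)
    qed
    then have "(\<integral>\<^sup>+x. ?f (x, y) \<partial>lborel) =
        (\<integral>\<^sup>+x. ennreal (gaussian_density B y) * ennreal (\<rho>2 (x + (- l))) \<partial>lborel)"
      by (simp only: ennreal_mult'[OF less_imp_le[OF gaussian_density_pos[OF B]]] prod.case)
    also have "\<dots> = ennreal (gaussian_density B y) * (\<integral>\<^sup>+x. ennreal (\<rho>2 (x + (- l))) \<partial>lborel)"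
      by (rule nn_integral_cmult) measurable
    also have "(\<integral>\<^sup>+x. ennreal (\<rho>2 (x + (- l))) \<partial>lborel) = (\<integral>\<^sup>+x. ennreal (\<rho>2 x) \<partial>lborel)"
      by (rule nn_integral_lborel_shift[where g="\<lambda>y. ennreal (\<rho>2 y)"]) measurable
    finally show ?thesis .
  qed
  show "distr (gaussian_prod S) borel snd = gaussian (block22 S)"
    unfolding f gaussian_def B_def[symmetric]
    by (rule distr_snd_density[OF _ _ fibre2 int_f int_g[OF B]]) simp_all
qed

section \<open>Gibbs' inequality\<close>

lemma space_gaussian_prod: "space (gaussian_prod S) = UNIV"
  by (simp add: gaussian_prod_def)

text \<open>Gibbs' inequality. With \<open>D = d\<pi>/d\<rho>\<close> and \<open>h = g / D\<close> one has \<open>ln g - ln D = ln h \<le> h - 1\<close>, and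
\<open>\<integral> h d\<pi> \<le> \<integral> g d\<rho> \<le> 1\<close>. The same bound shows that the negative part of \<open>ln D\<close> is integrable, so
either \<open>KL = \<infinity>\<close> or \<open>ln D\<close> is integrable.\<close>

lemma KL_ge_integral_ln:
  fixes g :: "'a \<Rightarrow> real"
  assumes \<rho>: "sigma_finite_measure \<rho>" and \<pi>: "prob_space \<pi>" and sets: "sets \<pi> = sets \<rho>"
    and [measurable]: "g \<in> borel_measurable \<rho>" and pos: "\<And>z. 0 < g z"
    and mass: "(\<integral>\<^sup>+z. ennreal (g z) \<partial>\<rho>) \<le> 1" and int: "integrable \<pi> (\<lambda>z. ln (g z))"
  shows "ereal (\<integral>z. ln (g z) \<partial>\<pi>) \<le> KL \<pi> \<rho>"
proof (cases "absolutely_continuous \<rho> \<pi>")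
  case ac: True
  interpret \<rho>: sigma_finite_measure \<rho> by fact
  interpret \<pi>: prob_space \<pi> by fact
  note [measurable_cong] = sets
  define E where "E = entropy_density (exp 1) \<rho> \<pi>"
  have [measurable]: "E \<in> borel_measurable \<rho>" unfolding E_def by (rule measurable_entropy_density)
  obtain D where [measurable]: "D \<in> borel_measurable \<rho>"
    and D: "AE z in \<rho>. RN_deriv \<rho> \<pi> z = ennreal (D z)" "AE z in \<pi>. 0 < D z" "\<And>z. 0 \<le> D z"
    using \<rho>.real_RN_deriv[OF \<pi>.finite_measure_axioms ac sets] by metis
  have \<pi>_eq: "\<pi> = density \<rho> (\<lambda>z. ennreal (D z))"
    using \<rho>.density_RN_deriv[OF ac sets] D(1) by (subst (asm) density_cong[OF _ _ D(1)]) auto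
  have AE_D: "AE z in \<pi>. RN_deriv \<rho> \<pi> z = ennreal (D z)"
    using absolutely_continuous_AE[OF sets ac D(1)] .
  have E: "AE z in \<pi>. 0 < D z \<and> E z = ln (D z)"
    using AE_D D(2)
    by eventually_elim (auto simp: E_def entropy_density_def log_def)
  define h where "h z = g z / D z" for z
  have [measurable]: "h \<in> borel_measurable \<rho>" unfolding h_def[abs_def] by measurable
  have h_nonneg: "0 \<le> h z" for z using pos[of z] D(3)[of z] by (simp add: h_def less_imp_le)
  have "(\<integral>\<^sup>+z. ennreal (h z) \<partial>\<pi>) = (\<integral>\<^sup>+z. ennreal (D z) * ennreal (h z) \<partial>\<rho>)"
    by (subst \<pi>_eq) (simp add: nn_integral_density)
  also have "\<dots> \<le> (\<integral>\<^sup>+z. ennreal (g z) \<partial>\<rho>)"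
    using D(3) h_nonneg pos
    by (intro nn_integral_mono) (auto simp: h_def ennreal_mult'[symmetric] less_imp_le)
  finally have h_mass: "(\<integral>\<^sup>+z. ennreal (h z) \<partial>\<pi>) \<le> 1" using mass by simp
  then have h_int: "integrable \<pi> h"
    using h_nonneg by (intro integrableI_nonneg) (auto intro: le_less_trans)
  have "ennreal (\<integral>z. h z \<partial>\<pi>) \<le> 1"
    using h_mass by (simp add: nn_integral_eq_integral[OF h_int] h_nonneg)
  then have h_le: "(\<integral>z. h z \<partial>\<pi>) \<le> 1" by (simp flip: ennreal_1 add: ennreal_le_iff)
  have gap: "AE z in \<pi>. ln (g z) - E z \<le> h z - 1"
    using E
  proof eventually_elim
    case (elim z)
    then have "ln (g z) - E z = ln (h z)" "0 < h z"
      using pos[of z] by (auto simp: h_def ln_div)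
    then show ?case using ln_le_minus_one by simp
  qed
  show ?thesis
  proof (cases "(\<integral>\<^sup>+z. ennreal (E z) \<partial>\<pi>) = \<infinity>")
    case True
    then show ?thesis using ac by (simp add: KL_def E_def[symmetric])
  next
    case False
    have "(\<integral>\<^sup>+z. ennreal (- E z) \<partial>\<pi>) \<le> (\<integral>\<^sup>+z. ennreal (h z + \<bar>ln (g z)\<bar>) \<partial>\<pi>)"
      using gap by (intro nn_integral_mono_AE) (auto elim!: eventually_mono intro!: ennreal_leI)
    also have "\<dots> < \<infinity>"
      using h_int int h_nonneg by (subst nn_integral_eq_integral) auto
    finally have neg: "(\<integral>\<^sup>+z. ennreal (- E z) \<partial>\<pi>) < \<infinity>" .
    then have E_int: "integrable \<pi> E"
      using False by (auto simp: real_integrable_def)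
    have "(\<integral>z. ln (g z) \<partial>\<pi>) - (\<integral>z. E z \<partial>\<pi>) = (\<integral>z. ln (g z) - E z \<partial>\<pi>)"
      using int E_int by simp
    also have "\<dots> \<le> (\<integral>z. h z - 1 \<partial>\<pi>)"
      using gap int E_int h_int by (intro integral_mono_AE) auto
    also have "\<dots> \<le> 0" using h_le h_int by (simp add: \<pi>.prob_space)
    finally have "(\<integral>z. ln (g z) \<partial>\<pi>) \<le> (\<integral>z. E z \<partial>\<pi>)" by simp
    moreover have "KL \<pi> \<rho> = ereal (\<integral>z. E z \<partial>\<pi>)"
      using ac neg False
      by (cases "\<integral>\<^sup>+z. ennreal (E z) \<partial>\<pi>"; cases "\<integral>\<^sup>+z. ennreal (- E z) \<partial>\<pi>")
        (simp_all add: KL_def E_def[symmetric] real_lebesgue_integral_def[OF E_int])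
    ultimately show ?thesis by simp
  qed
qed (simp add: KL_def)

lemma KL_density_eq_integral_ln:
  fixes g :: "'a \<Rightarrow> real"
  assumes \<rho>: "sigma_finite_measure \<rho>"
    and [measurable]: "g \<in> borel_measurable \<rho>" and pos: "\<And>z. 0 < g z"
    and \<pi>: "\<pi> = density \<rho> (\<lambda>z. ennreal (g z))" and int: "integrable \<pi> (\<lambda>z. ln (g z))"
  shows "KL \<pi> \<rho> = ereal (\<integral>z. ln (g z) \<partial>\<pi>)"
proof -
  interpret \<rho>: sigma_finite_measure \<rho> by fact
  have sets: "sets \<pi> = sets \<rho>" by (simp add: \<pi>)
  have ac: "absolutely_continuous \<rho> \<pi>" unfolding \<pi> by (rule absolutely_continuousI_density) simp
  have "AE z in \<rho>. ennreal (g z) = RN_deriv \<rho> \<pi> z"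
    by (rule \<rho>.RN_deriv_unique[OF _ \<pi>[symmetric]]) simp
  then have "AE z in \<rho>. entropy_density (exp 1) \<rho> \<pi> z = ln (g z)"
  proof eventually_elim
    case (elim z)
    then show ?case
      using pos[of z] by (simp add: entropy_density_def log_def elim[symmetric])
  qed
  then have E: "AE z in \<pi>. entropy_density (exp 1) \<rho> \<pi> z = ln (g z)"
    by (rule absolutely_continuous_AE[OF sets ac])
  have "KL \<pi> \<rho> = enn2ereal (\<integral>\<^sup>+z. ennreal (ln (g z)) \<partial>\<pi>) - enn2ereal (\<integral>\<^sup>+z. ennreal (- ln (g z)) \<partial>\<pi>)"
    using E ac unfolding KL_def
    by (subst (1 2) nn_integral_cong_AE) (auto elim!: eventually_mono)
  also have "\<dots> = ereal (\<integral>z. ln (g z) \<partial>\<pi>)"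
    using int unfolding real_lebesgue_integral_def[OF int] real_integrable_def
    by (cases "\<integral>\<^sup>+z. ennreal (ln (g z)) \<partial>\<pi>"; cases "\<integral>\<^sup>+z. ennreal (- ln (g z)) \<partial>\<pi>") simp_all
  finally show ?thesis .
qed

section \<open>Weak duality\<close>

lemma block_matrix_nth [simp]:
  "block_matrix P Q R S $ Inl i = stack (P $ i) (Q $ i)"
  "block_matrix P Q R S $ Inr i = stack (R $ i) (S $ i)"
  by (simp_all add: block_matrix_def)

lemma block_matrix_mult_stack:
  "block_matrix P Q R S *v stack x y = stack (P *v x + Q *v y) (R *v x + S *v y)"
  by (simp add: vec_sum_eq_iff matrix_vector_mul_component stack_inner)

lemma block_matrix_quadratic_form:
  "stack x y \<bullet> (block_matrix P Q (transpose Q) R *v stack x y) =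
    x \<bullet> (P *v x) + 2 * (x \<bullet> (Q *v y)) + y \<bullet> (R *v y)"
  by (simp add: block_matrix_mult_stack stack_inner inner_add_right inner_commute
      inner_matrix_vector_swap[of x Q y])

lemma block_matrix_symmetric:
  assumes "transpose S = S"
  shows "S = block_matrix (block11 S) (block12 S) (transpose (block12 S)) (block22 S)"
proof -
  have "S $ a $ b = S $ b $ a" for a b
    by (subst (1) assms[symmetric]) (simp add: transpose_def)
  then show ?thesis
    by (simp add: vec_sum_eq_iff block11_def block12_def block22_def transpose_def)
qed

lemma det_scaleR: "det (c *\<^sub>R P) = c ^ CARD('k) * det P" for P :: "real^'k^'k"
  by (simp add: det_def prod.distrib sum_distrib_left mult_ac)

lemma hs_inner_simps:
  "hs_inner (P + Q) A = hs_inner P A + hs_inner Q A"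
  "hs_inner (P - Q) A = hs_inner P A - hs_inner Q A"
  "hs_inner (c *\<^sub>R P) A = c * hs_inner P A"
  by (simp_all add: hs_inner_def trace_def matrix_matrix_mult_def sum.distrib sum_subtractf
      algebra_simps sum_distrib_left)

lemma ln_gaussian_density:
  fixes S :: "real^'k^'k"
  assumes "S \<in> spd"
  shows "ln (gaussian_density S z) =
    - (z \<bullet> (matrix_inv S *v z)) / 2 - ln ((2 * pi) ^ CARD('k)) / 2 - ln (det S) / 2"
  using spd_det_pos[OF assms]
  by (simp add: gaussian_density_def ln_div ln_mult ln_sqrt add_divide_distrib real_sqrt_mult)

definition transport_objective ::
    "real \<Rightarrow> real^('n::finite + 'n)^('n + 'n) \<Rightarrow> ((real^'n) \<times> (real^'n)) measure \<Rightarrow> ereal" where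
  "transport_objective \<epsilon> \<Sigma> \<pi> =
     enn2ereal (\<integral>\<^sup>+(x, y). ennreal ((norm (x - y))\<^sup>2) \<partial>\<pi>) + ereal (2 * \<epsilon>) * KL \<pi> (gaussian_prod \<Sigma>)"

text \<open>The right-hand side of the duality formula as a real number. It is the intended value only if the
block matrix is positive definite; otherwise the dual objective is \<open>- \<infinity>\<close>.\<close>

definition dual_value ::
    "real \<Rightarrow> real^('n::finite + 'n)^('n + 'n) \<Rightarrow> real^'n^'n \<Rightarrow> real^'n^'n \<Rightarrow> real^'n^'n \<Rightarrow> real^'n^'n \<Rightarrow> real" where
  "dual_value \<epsilon> \<Sigma> A B F G =
     (let M = mat 1 - \<epsilon> *\<^sub>R block12 (matrix_inv \<Sigma>)
      in hs_inner (mat 1 - F) A + hs_inner (mat 1 - G) B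
         + \<epsilon> * ln (det (block_matrix F (- M) (- transpose M) G)))
     + \<epsilon> * (hs_inner (block11 (matrix_inv \<Sigma>)) A + hs_inner (block22 (matrix_inv \<Sigma>)) B
            - ln (det (\<epsilon> *\<^sub>R matrix_inv \<Sigma>)))"

lemma coupling_quadratic_forms:
  fixes A B :: "real^'n^'n"
  assumes "\<pi> \<in> couplings (gaussian A) (gaussian B)" and "A \<in> spd" and "B \<in> spd"
  shows "integrable \<pi> (\<lambda>z. fst z \<bullet> (Q *v fst z))" "(\<integral>z. fst z \<bullet> (Q *v fst z) \<partial>\<pi>) = hs_inner Q A"
    and "integrable \<pi> (\<lambda>z. snd z \<bullet> (Q *v snd z))" "(\<integral>z. snd z \<bullet> (Q *v snd z) \<partial>\<pi>) = hs_inner Q B"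
proof -
  have [measurable_cong]: "sets \<pi> = sets borel" and A: "distr \<pi> borel fst = gaussian A"
    and B: "distr \<pi> borel snd = gaussian B"
    using assms(1) by (auto simp: couplings_def)
  show "integrable \<pi> (\<lambda>z. fst z \<bullet> (Q *v fst z))"
    using gaussian_quadratic_form(1)[OF assms(2), of Q] unfolding A[symmetric]
    by (subst (asm) integrable_distr_eq) simp_all
  show "(\<integral>z. fst z \<bullet> (Q *v fst z) \<partial>\<pi>) = hs_inner Q A"
    using gaussian_quadratic_form(2)[OF assms(2), of Q] unfolding A[symmetric]
    by (subst (asm) integral_distr) simp_all
  show "integrable \<pi> (\<lambda>z. snd z \<bullet> (Q *v snd z))"
    using gaussian_quadratic_form(1)[OF assms(3), of Q] unfolding B[symmetric]
    by (subst (asm) integrable_distr_eq) simp_all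
  show "(\<integral>z. snd z \<bullet> (Q *v snd z) \<partial>\<pi>) = hs_inner Q B"
    using gaussian_quadratic_form(2)[OF assms(3), of Q] unfolding B[symmetric]
    by (subst (asm) integral_distr) simp_all
qed

definition gaussian_ratio ::
    "real^('n::finite + 'n)^('n + 'n) \<Rightarrow> real^('n + 'n)^('n + 'n) \<Rightarrow> (real^'n) \<times> (real^'n) \<Rightarrow> real" where
  "gaussian_ratio S \<Sigma> z =
     gaussian_density S (stack (fst z) (snd z)) / gaussian_density \<Sigma> (stack (fst z) (snd z))"

lemma gaussian_ratio_measurable [measurable]: "gaussian_ratio S \<Sigma> \<in> borel_measurable borel"
  unfolding gaussian_ratio_def[abs_def] by measurable

lemma gaussian_ratio_pos: "S \<in> spd \<Longrightarrow> \<Sigma> \<in> spd \<Longrightarrow> 0 < gaussian_ratio S \<Sigma> z"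
  by (simp add: gaussian_ratio_def gaussian_density_pos)

lemma gaussian_prod_eq_density:
  assumes "S \<in> spd" and "\<Sigma> \<in> spd"
  shows "gaussian_prod S = density (gaussian_prod \<Sigma>) (\<lambda>z. ennreal (gaussian_ratio S \<Sigma> z))"
proof -
  have "gaussian_density \<Sigma> (stack (fst z) (snd z)) * gaussian_ratio S \<Sigma> z =
      gaussian_density S (stack (fst z) (snd z))" for z
    using gaussian_density_pos[OF assms(2), of "stack (fst z) (snd z)"] by (simp add: gaussian_ratio_def)
  then show ?thesis
    unfolding gaussian_prod_def case_prod_unfold
    by (subst density_density_eq)
      (simp_all add: ennreal_mult'[symmetric] gaussian_density_pos[OF assms(2)] less_imp_le)
qed

text \<open>The heart of the duality. Since \<open>S\<^sup>-\<^sup>1 = K / \<epsilon>\<close>, the logarithm contributes \<open>- z \<bullet> K z + \<epsilon> z \<bullet> \<Gamma> z\<close>, with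
mixed terms \<open>2 x \<bullet> M y + 2 \<epsilon> x \<bullet> \<Gamma>\<^sub>1\<^sub>2 y = 2 x \<bullet> y\<close>. They cancel against the mixed term of the cost.\<close>

lemma cost_plus_log_ratio:
  fixes \<Sigma> S :: "real^('n::finite + 'n)^('n + 'n)" and \<epsilon> :: real and F G :: "real^'n^'n"
  defines "\<Gamma> \<equiv> matrix_inv \<Sigma>"
  defines "M \<equiv> mat 1 - \<epsilon> *\<^sub>R block12 \<Gamma>"
  defines "K \<equiv> block_matrix F (- M) (- transpose M) G"
  assumes \<Sigma>: "\<Sigma> \<in> spd" and \<epsilon>: "0 < \<epsilon>" and K: "K \<in> spd" and S: "S = \<epsilon> *\<^sub>R matrix_inv K"
  shows "(norm (fst z - snd z))\<^sup>2 + 2 * \<epsilon> * ln (gaussian_ratio S \<Sigma> z) =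
    fst z \<bullet> ((mat 1 - F + \<epsilon> *\<^sub>R block11 \<Gamma>) *v fst z) +
    snd z \<bullet> ((mat 1 - G + \<epsilon> *\<^sub>R block22 \<Gamma>) *v snd z) + \<epsilon> * (ln (det K) - ln (det (\<epsilon> *\<^sub>R \<Gamma>)))"
proof -
  obtain x y where z: "z = (x, y)" by (cases z)
  have Sspd: "S \<in> spd" unfolding S by (intro spd_scaleR spd_matrix_inv K \<epsilon>)
  have inv: "matrix_inv S = (1 / \<epsilon>) *\<^sub>R K"
    by (rule matrix_inv_unique) (use \<epsilon> in \<open>simp add: S matrix_scalar_ac scalar_matrix_assoc[symmetric] spd_inv_left[OF K]\<close>)
  have "ln (gaussian_ratio S \<Sigma> z) =
      ln (gaussian_density S (stack x y)) - ln (gaussian_density \<Sigma> (stack x y))"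
    using gaussian_density_pos[OF Sspd, of "stack x y"] gaussian_density_pos[OF \<Sigma>, of "stack x y"]
    by (simp add: gaussian_ratio_def z ln_div)
  also have "\<dots> = - (stack x y \<bullet> (matrix_inv S *v stack x y)) / 2
      + (stack x y \<bullet> (\<Gamma> *v stack x y)) / 2 + (ln (det \<Sigma>) - ln (det S)) / 2"
    by (simp add: ln_gaussian_density[OF Sspd] ln_gaussian_density[OF \<Sigma>] \<Gamma>_def field_simps)
  also have "stack x y \<bullet> (matrix_inv S *v stack x y) = (stack x y \<bullet> (K *v stack x y)) / \<epsilon>"
    by (simp add: inv scaleR_matrix_vector_assoc[symmetric])
  finally have "2 * \<epsilon> * ln (gaussian_ratio S \<Sigma> z) = - (stack x y \<bullet> (K *v stack x y))
      + \<epsilon> * (stack x y \<bullet> (\<Gamma> *v stack x y)) + \<epsilon> * (ln (det \<Sigma>) - ln (det S))"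
    using \<epsilon> by (simp add: field_simps)
  moreover have "stack x y \<bullet> (K *v stack x y) = x \<bullet> (F *v x) - 2 * (x \<bullet> (M *v y)) + y \<bullet> (G *v y)"
  proof -
    have tM: "- transpose M = transpose (- M)" by (simp add: transpose_def vec_eq_iff)
    have "(- M) *v y = - (M *v y)" by (metis diff_0 matrix_vector_mult_0 matrix_vector_mult_diff_rdistrib)
    then show ?thesis
      unfolding K_def tM by (simp add: block_matrix_quadratic_form)
  qed
  moreover have "stack x y \<bullet> (\<Gamma> *v stack x y) =
      x \<bullet> (block11 \<Gamma> *v x) + 2 * (x \<bullet> (block12 \<Gamma> *v y)) + y \<bullet> (block22 \<Gamma> *v y)"
    using spd_sym[OF spd_matrix_inv[OF \<Sigma>]] unfolding \<Gamma>_def[symmetric]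
    by (subst (1) block_matrix_symmetric) (simp_all add: block_matrix_quadratic_form)
  moreover have "x \<bullet> (M *v y) = x \<bullet> y - \<epsilon> * (x \<bullet> (block12 \<Gamma> *v y))"
    by (simp add: M_def matrix_vector_mult_diff_rdistrib scaleR_matrix_vector_assoc[symmetric] inner_diff_right)
  moreover have "ln (det \<Sigma>) - ln (det S) = ln (det K) - ln (det (\<epsilon> *\<^sub>R \<Gamma>))"
    using \<epsilon> spd_det_pos[OF \<Sigma>] spd_det_pos[OF K]
    by (simp add: S \<Gamma>_def det_scaleR det_matrix_inv[OF \<Sigma>] det_matrix_inv[OF K] ln_div ln_mult)
  moreover have "(norm (x - y))\<^sup>2 = x \<bullet> x - 2 * (x \<bullet> y) + y \<bullet> y"
    by (simp add: power2_norm_eq_inner inner_diff_left inner_diff_right inner_commute)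
  ultimately show ?thesis
    by (simp add: z matrix_vector_mult_diff_rdistrib matrix_vector_mult_add_rdistrib
        scaleR_matrix_vector_assoc[symmetric] inner_diff_right inner_add_right algebra_simps)
qed

text \<open>Only the marginals of \<open>\<pi>\<close> enter, because the cost plus the logarithm is a function of \<open>x\<close> plus a
function of \<open>y\<close>.\<close>

lemma coupling_cost_plus_log_ratio:
  fixes \<Sigma> S :: "real^('n::finite + 'n)^('n + 'n)" and \<epsilon> :: real and A B F G :: "real^'n^'n"
  defines "M \<equiv> mat 1 - \<epsilon> *\<^sub>R block12 (matrix_inv \<Sigma>)"
  defines "K \<equiv> block_matrix F (- M) (- transpose M) G"
  assumes A: "A \<in> spd" and B: "B \<in> spd" and \<Sigma>: "\<Sigma> \<in> spd" and \<epsilon>: "0 < \<epsilon>"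
    and K: "K \<in> spd" and S: "S = \<epsilon> *\<^sub>R matrix_inv K"
    and \<pi>: "\<pi> \<in> couplings (gaussian A) (gaussian B)"
  shows "integrable \<pi> (\<lambda>z. ln (gaussian_ratio S \<Sigma> z))"
    and "enn2ereal (\<integral>\<^sup>+(x, y). ennreal ((norm (x - y))\<^sup>2) \<partial>\<pi>)
      + ereal (2 * \<epsilon>) * ereal (\<integral>z. ln (gaussian_ratio S \<Sigma> z) \<partial>\<pi>) = ereal (dual_value \<epsilon> \<Sigma> A B F G)"
proof -
  define \<Gamma> where "\<Gamma> = matrix_inv \<Sigma>"
  interpret \<pi>: prob_space \<pi> using \<pi> by (simp add: couplings_def)
  have [measurable_cong]: "sets \<pi> = sets borel" using \<pi> by (simp add: couplings_def)
  note quad = coupling_quadratic_forms[OF \<pi> A B]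
  define c :: "(real^'n) \<times> (real^'n) \<Rightarrow> real" where "c z = (norm (fst z - snd z))\<^sup>2" for z
  define r where "r z = fst z \<bullet> ((mat 1 - F + \<epsilon> *\<^sub>R block11 \<Gamma>) *v fst z) +
    snd z \<bullet> ((mat 1 - G + \<epsilon> *\<^sub>R block22 \<Gamma>) *v snd z) + \<epsilon> * (ln (det K) - ln (det (\<epsilon> *\<^sub>R \<Gamma>)))" for z
  have cr: "c z + 2 * \<epsilon> * ln (gaussian_ratio S \<Sigma> z) = r z" for z
    using cost_plus_log_ratio[OF \<Sigma> \<epsilon> K[unfolded K_def M_def] S[unfolded K_def M_def], of z]
    unfolding c_def r_def K_def M_def \<Gamma>_def .
  have [measurable]: "c \<in> borel_measurable borel" unfolding c_def[abs_def] by measurable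
  have c_int: "integrable \<pi> c"
  proof (rule Bochner_Integration.integrable_bound)
    show "integrable \<pi> (\<lambda>z. 2 * (fst z \<bullet> (mat 1 *v fst z)) + 2 * (snd z \<bullet> (mat 1 *v snd z)))"
      by (intro Bochner_Integration.integrable_add integrable_mult_right quad)
    have "(norm (x - y))\<^sup>2 \<le> 2 * (x \<bullet> x) + 2 * (y \<bullet> y)" for x y :: "real^'n"
      using inner_ge_zero[of "x + y"]
      by (simp add: power2_norm_eq_inner inner_diff_left inner_diff_right inner_add_left inner_add_right inner_commute)
    then show "AE z in \<pi>. norm (c z) \<le>
        norm (2 * (fst z \<bullet> (mat 1 *v fst z)) + 2 * (snd z \<bullet> (mat 1 *v snd z)))"
      by (auto simp: c_def intro: order_trans)
  qed simp
  have r_int: "integrable \<pi> r"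
    unfolding r_def[abs_def] by (intro Bochner_Integration.integrable_add quad) simp
  \<comment> \<open>integrability of the logarithm is read off from the other two terms of the identity\<close>
  have lnr: "(\<lambda>z. ln (gaussian_ratio S \<Sigma> z)) = (\<lambda>z. (r z - c z) / (2 * \<epsilon>))"
    using \<epsilon> by (simp add: cr[symmetric])
  show int: "integrable \<pi> (\<lambda>z. ln (gaussian_ratio S \<Sigma> z))"
    unfolding lnr using c_int r_int by simp
  have "(\<integral>\<^sup>+(x, y). ennreal ((norm (x - y))\<^sup>2) \<partial>\<pi>) = ennreal (\<integral>z. c z \<partial>\<pi>)"
    using nn_integral_eq_integral[OF c_int] by (simp add: c_def[abs_def] case_prod_unfold)
  moreover have "0 \<le> (\<integral>z. c z \<partial>\<pi>)" by (simp add: c_def)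
  ultimately have "enn2ereal (\<integral>\<^sup>+(x, y). ennreal ((norm (x - y))\<^sup>2) \<partial>\<pi>) = ereal (\<integral>z. c z \<partial>\<pi>)"
    by (simp add: enn2ereal_ennreal)
  moreover have "(\<integral>z. c z \<partial>\<pi>) + 2 * \<epsilon> * (\<integral>z. ln (gaussian_ratio S \<Sigma> z) \<partial>\<pi>) = (\<integral>z. r z \<partial>\<pi>)"
    using c_int int by (simp add: cr[symmetric])
  moreover have "(\<integral>z. r z \<partial>\<pi>) = hs_inner (mat 1 - F + \<epsilon> *\<^sub>R block11 \<Gamma>) A
      + hs_inner (mat 1 - G + \<epsilon> *\<^sub>R block22 \<Gamma>) B + \<epsilon> * (ln (det K) - ln (det (\<epsilon> *\<^sub>R \<Gamma>)))"
    unfolding r_def[abs_def] using quad by (simp add: \<pi>.prob_space)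
  moreover have "\<dots> = dual_value \<epsilon> \<Sigma> A B F G"
    by (simp add: dual_value_def Let_def hs_inner_simps K_def M_def \<Gamma>_def algebra_simps)
  ultimately show "enn2ereal (\<integral>\<^sup>+(x, y). ennreal ((norm (x - y))\<^sup>2) \<partial>\<pi>)
      + ereal (2 * \<epsilon>) * ereal (\<integral>z. ln (gaussian_ratio S \<Sigma> z) \<partial>\<pi>) = ereal (dual_value \<epsilon> \<Sigma> A B F G)"
    by simp
qed

lemma weak_duality:
  fixes \<Sigma> :: "real^('n::finite + 'n)^('n + 'n)" and \<epsilon> :: real and A B F G :: "real^'n^'n"
  defines "M \<equiv> mat 1 - \<epsilon> *\<^sub>R block12 (matrix_inv \<Sigma>)"
  assumes A: "A \<in> spd" and B: "B \<in> spd" and \<Sigma>: "\<Sigma> \<in> spd" and \<epsilon>: "0 < \<epsilon>"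
    and K: "block_matrix F (- M) (- transpose M) G \<in> spd"
    and \<pi>: "\<pi> \<in> couplings (gaussian A) (gaussian B)"
  shows "ereal (dual_value \<epsilon> \<Sigma> A B F G) \<le> transport_objective \<epsilon> \<Sigma> \<pi>"
proof -
  define S where "S = \<epsilon> *\<^sub>R matrix_inv (block_matrix F (- M) (- transpose M) G)"
  have S: "S \<in> spd" unfolding S_def by (intro spd_scaleR spd_matrix_inv K \<epsilon>)
  interpret \<rho>: prob_space "gaussian_prod \<Sigma>" by (rule prob_space_gaussian_prod[OF \<Sigma>])
  interpret g: prob_space "gaussian_prod S" by (rule prob_space_gaussian_prod[OF S])
  note * = coupling_cost_plus_log_ratio[OF A B \<Sigma> \<epsilon> K[unfolded M_def] S_def[unfolded M_def] \<pi>]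
  have "ereal (\<integral>z. ln (gaussian_ratio S \<Sigma> z) \<partial>\<pi>) \<le> KL \<pi> (gaussian_prod \<Sigma>)"
  proof (rule KL_ge_integral_ln)
    show "(\<integral>\<^sup>+z. ennreal (gaussian_ratio S \<Sigma> z) \<partial>gaussian_prod \<Sigma>) \<le> 1"
      using g.emeasure_space_1 unfolding gaussian_prod_eq_density[OF S \<Sigma>]
      by (subst (asm) emeasure_density) (simp_all add: space_gaussian_prod)
  qed (use \<pi> *(1) in \<open>auto simp: couplings_def gaussian_ratio_pos[OF S \<Sigma>] \<rho>.sigma_finite_measure_axioms\<close>)
  then have "ereal (2 * \<epsilon>) * ereal (\<integral>z. ln (gaussian_ratio S \<Sigma> z) \<partial>\<pi>) \<le> ereal (2 * \<epsilon>) * KL \<pi> (gaussian_prod \<Sigma>)"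
    using \<epsilon> by (intro ereal_mult_left_mono) auto
  then show ?thesis
    unfolding transport_objective_def *(2)[symmetric] by (intro add_left_mono)
qed

lemma gaussian_prod_attains_dual_value:
  fixes \<Sigma> :: "real^('n::finite + 'n)^('n + 'n)" and \<epsilon> :: real and A B F G :: "real^'n^'n"
  defines "M \<equiv> mat 1 - \<epsilon> *\<^sub>R block12 (matrix_inv \<Sigma>)"
  assumes A: "A \<in> spd" and B: "B \<in> spd" and \<Sigma>: "\<Sigma> \<in> spd" and \<epsilon>: "0 < \<epsilon>"
    and K: "block_matrix F (- M) (- transpose M) G \<in> spd"
    and S: "S = \<epsilon> *\<^sub>R matrix_inv (block_matrix F (- M) (- transpose M) G)"
    and \<pi>: "gaussian_prod S \<in> couplings (gaussian A) (gaussian B)"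
  shows "transport_objective \<epsilon> \<Sigma> (gaussian_prod S) = ereal (dual_value \<epsilon> \<Sigma> A B F G)"
proof -
  have Sspd: "S \<in> spd" unfolding S by (intro spd_scaleR spd_matrix_inv K \<epsilon>)
  interpret \<rho>: prob_space "gaussian_prod \<Sigma>" by (rule prob_space_gaussian_prod[OF \<Sigma>])
  note * = coupling_cost_plus_log_ratio[OF A B \<Sigma> \<epsilon> K[unfolded M_def] S[unfolded M_def] \<pi>]
  have "KL (gaussian_prod S) (gaussian_prod \<Sigma>) = ereal (\<integral>z. ln (gaussian_ratio S \<Sigma> z) \<partial>gaussian_prod S)"
    by (rule KL_density_eq_integral_ln[OF \<rho>.sigma_finite_measure_axioms _ _ gaussian_prod_eq_density[OF Sspd \<Sigma>] *(1)])
      (simp_all add: gaussian_ratio_pos[OF Sspd \<Sigma>])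
  then show ?thesis unfolding transport_objective_def *(2)[symmetric] by simp
qed

section \<open>A covariance with prescribed diagonal blocks and off-diagonal precision\<close>

lemma spd_lower_bound:
  fixes S :: "real^'k^'k"
  assumes "S \<in> spd"
  obtains c where "0 < c" and "\<And>z. c * (z \<bullet> z) \<le> z \<bullet> (S *v z)"
proof -
  have cont: "continuous_on (sphere 0 1) (\<lambda>z. z \<bullet> (S *v z))"
    by (intro continuous_intros linear_continuous_on matrix_vector_mul_bounded_linear)
  have "axis undefined 1 \<in> sphere (0 :: real^'k) 1" by simp
  then have "sphere (0 :: real^'k) 1 \<noteq> {}" by blast
  from continuous_attains_inf[OF compact_sphere this cont] obtain u where u: "u \<in> sphere 0 1" and min: "\<And>z. z \<in> sphere 0 1 \<Longrightarrow> u \<bullet> (S *v u) \<le> z \<bullet> (S *v z)"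
    by blast
  have "u \<bullet> (S *v u) * (z \<bullet> z) \<le> z \<bullet> (S *v z)" for z
  proof (cases "z = 0")
    case False
    define n where "n = norm z"
    have "0 < n" using False by (simp add: n_def)
    have "u \<bullet> (S *v u) \<le> ((1 / n) *\<^sub>R z) \<bullet> (S *v ((1 / n) *\<^sub>R z))"
      by (rule min) (use \<open>0 < n\<close> in \<open>simp add: n_def\<close>)
    also have "\<dots> = z \<bullet> (S *v z) / n\<^sup>2"
      by (simp add: matrix_vector_mult_scaleR power2_eq_square)
    finally show ?thesis
      using \<open>0 < n\<close> by (simp add: field_simps n_def power2_norm_eq_inner)
  qed simp
  moreover have "0 < u \<bullet> (S *v u)" using u by (intro spd_pos[OF assms]) auto
  ultimately show ?thesis using that by blast
qed

text \<open>If \<open>z \<bullet> S z = 0\<close>, then moving from \<open>z\<close> in the direction \<open>- S z\<close> makes the form negative, unless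
\<open>S z = 0\<close>.\<close>

lemma spd_of_semidefinite:
  fixes S :: "real^'k^'k"
  assumes sym: "transpose S = S" and psd: "\<And>z. 0 \<le> z \<bullet> (S *v z)" and "det S \<noteq> 0"
  shows "S \<in> spd"
proof -
  have "0 < z \<bullet> (S *v z)" if "z \<noteq> 0" for z
  proof (rule ccontr)
    assume "\<not> 0 < z \<bullet> (S *v z)"
    then have zero: "z \<bullet> (S *v z) = 0" using psd[of z] by simp
    define w where "w = S *v z"
    have zw: "z \<bullet> (S *v w) = w \<bullet> w"
      by (subst inner_matrix_vector_swap) (simp only: sym w_def)
    have "w \<noteq> 0"
    proof
      assume "w = 0"
      have "inj ((*v) S)"
        using assms(3) by (simp add: inj_matrix_vector_mult invertible_det_nz)
      then show False using \<open>w = 0\<close> that injD[of "(*v) S" z 0] by (simp add: w_def)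
    qed
    define a where "a = w \<bullet> (S *v w)"
    \<comment> \<open>the denominator \<open>1 + a\<close> keeps \<open>t a \<le> w \<bullet> w\<close> and covers \<open>a = 0\<close>\<close>
    define t where "t = (w \<bullet> w) / (1 + a)"
    have "0 \<le> a" using psd[of w] by (simp add: a_def)
    have "0 < w \<bullet> w" using \<open>w \<noteq> 0\<close> by simp
    then have "0 < t" using \<open>0 \<le> a\<close> by (simp add: t_def)
    have "0 \<le> (z - t *\<^sub>R w) \<bullet> (S *v (z - t *\<^sub>R w))" by (rule psd)
    also have "\<dots> = t * (t * a - 2 * (w \<bullet> w))"
      using zero zw by (simp add: matrix_vector_mult_diff_distrib matrix_vector_mult_scaleR
          inner_diff_left inner_diff_right a_def w_def[symmetric] inner_commute algebra_simps)
    also have "t * a \<le> w \<bullet> w"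
      using \<open>0 < w \<bullet> w\<close> \<open>0 \<le> a\<close> by (simp add: t_def field_simps)
    then have "t * (t * a - 2 * (w \<bullet> w)) < 0"
      using \<open>0 < t\<close> \<open>0 < w \<bullet> w\<close> by (intro mult_pos_neg) linarith+
    finally show False by simp
  qed
  then show ?thesis using sym by (simp add: spd_def)
qed

text \<open>Cramer's rule: the row \<open>axis j 1\<close> is the combination of the rows of \<open>S\<close> with the coefficients
\<open>P $ j\<close>.\<close>

lemma det_replace_row_axis:
  fixes S :: "real^'k^'k"
  assumes "P ** S = mat 1"
  shows "det (\<chi> i. if i = k then axis j 1 else S $ i) = P $ j $ k * det S"
proof -
  have "(\<Sum>i\<in>UNIV. P $ j $ i *s row i S) = axis j 1"
  proof -
    have "(\<Sum>i\<in>UNIV. P $ j $ i *s row i S) = (P ** S) $ j"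
      by (simp add: vec_eq_iff matrix_matrix_mult_def row_def)
    then show ?thesis by (simp add: assms mat_def axis_def vec_eq_iff eq_commute)
  qed
  moreover have "row i S = S $ i" for i by (simp add: row_def vec_eq_iff)
  ultimately show ?thesis using cramer_lemma_transpose[of k "P $ j" S] by (simp cong: if_cong)
qed

text \<open>The perturbation changes two rows, so by multilinearity the determinant is a quadratic polynomial
in \<open>t\<close>. Only its linear coefficient matters: it is the derivative in the first-order condition.\<close>

lemma det_symmetric_perturbation:
  fixes S :: "real^'k^'k"
  assumes PS: "P ** S = mat 1" and "a \<noteq> b"
  obtains c where "\<And>t. det (S + t *\<^sub>R (axis a (axis b 1) + axis b (axis a 1))) =
    det S + t * ((P $ b $ a + P $ a $ b) * det S) + t\<^sup>2 * c"
proof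
  \<comment> \<open>\<open>R t\<close> has only row \<open>b\<close> perturbed; in \<open>U\<close> row \<open>a\<close> is replaced by its increment\<close>
  define R where "R t = (\<lambda>i. if i = b then S $ b + t *s axis a 1 else S $ i)" for t
  define U where "U = (\<lambda>i. if i = a then axis b 1 else S $ i)"
  define c where "c = det (\<chi> i. if i = b then axis a 1 else U i)"
  fix t :: real
  have "S + t *\<^sub>R (axis a (axis b 1) + axis b (axis a 1)) =
      (\<chi> i. if i = a then S $ a + t *s axis b 1 else R t i)"
    using \<open>a \<noteq> b\<close> by (auto simp: vec_eq_iff R_def axis_def)
  then have "det (S + t *\<^sub>R (axis a (axis b 1) + axis b (axis a 1))) =
      det (\<chi> i. if i = a then S $ a else R t i) + t * det (\<chi> i. if i = a then axis b 1 else R t i)"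
    using det_row_add[of a "\<lambda>_. S $ a" "\<lambda>_. t *s axis b 1" "R t"] det_row_mul[of a t "\<lambda>_. axis b 1" "R t"]
    by simp
  moreover have "det (\<chi> i. if i = a then S $ a else R t i) = det S + t * (P $ a $ b * det S)"
  proof -
    have "(\<chi> i. if i = a then S $ a else R t i) = (\<chi> i. if i = b then S $ b + t *s axis a 1 else S $ i)"
      using \<open>a \<noteq> b\<close> by (auto simp: R_def vec_eq_iff)
    moreover have "(\<chi> i. if i = b then S $ b else S $ i) = S" by (simp add: vec_eq_iff)
    ultimately show ?thesis
      using det_row_add[of b "\<lambda>_. S $ b" "\<lambda>_. t *s axis a 1" "\<lambda>i. S $ i"]
        det_row_mul[of b t "\<lambda>_. axis a 1" "\<lambda>i. S $ i"] det_replace_row_axis[OF PS, of b a]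
      by simp
  qed
  moreover have "det (\<chi> i. if i = a then axis b 1 else R t i) = P $ b $ a * det S + t * c"
  proof -
    have "(\<chi> i. if i = a then axis b 1 else R t i) = (\<chi> i. if i = b then S $ b + t *s axis a 1 else U i)"
      using \<open>a \<noteq> b\<close> by (auto simp: R_def U_def vec_eq_iff)
    moreover have "(\<chi> i. if i = b then S $ b else U i) = (\<chi> i. if i = a then axis b 1 else S $ i)"
      using \<open>a \<noteq> b\<close> by (auto simp: U_def vec_eq_iff)
    ultimately show ?thesis
      using det_row_add[of b "\<lambda>_. S $ b" "\<lambda>_. t *s axis a 1" U]
        det_row_mul[of b t "\<lambda>_. axis a 1" U] det_replace_row_axis[OF PS, of a b]
      by (simp add: c_def)
  qed
  ultimately show "det (S + t *\<^sub>R (axis a (axis b 1) + axis b (axis a 1))) =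
    det S + t * ((P $ b $ a + P $ a $ b) * det S) + t\<^sup>2 * c"
    by (simp add: algebra_simps power2_eq_square)
qed

lemma transpose_block_matrix:
  "transpose (block_matrix P Q R S) =
    block_matrix (transpose P) (transpose R) (transpose Q) (transpose S)"
  by (simp add: vec_sum_eq_iff transpose_def)

lemma spd_block_diagonal:
  fixes A B :: "real^'n^'n"
  assumes "A \<in> spd" and "B \<in> spd"
  shows "block_matrix A 0 (transpose 0) B \<in> spd"
proof -
  have "0 < z \<bullet> (block_matrix A 0 (transpose 0) B *v z)" if "z \<noteq> 0" for z
  proof -
    obtain x y where z: "z = stack x y" by (rule stack_cases)
    have "x \<noteq> 0 \<or> y \<noteq> 0" using that by (simp add: z stack_eq_0_iff)
    then show ?thesis
      using spd_nonneg[OF assms(1), of x] spd_nonneg[OF assms(2), of y]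
        spd_pos[OF assms(1), of x] spd_pos[OF assms(2), of y]
      unfolding z block_matrix_quadratic_form by fastforce
  qed
  moreover have "transpose (block_matrix A 0 (transpose 0) B) = block_matrix A 0 (transpose 0) B"
    by (simp add: transpose_block_matrix spd_sym assms)
  ultimately show ?thesis by (simp add: spd_def)
qed

lemma det_continuous_on:
  fixes f :: "'a::topological_space \<Rightarrow> real^'k^'k"
  assumes "\<And>i j. continuous_on X (\<lambda>x. f x $ i $ j)"
  shows "continuous_on X (\<lambda>x. det (f x))"
  unfolding det_def by (intro continuous_intros assms)

text \<open>The function \<open>f C = exp (2 (m \<bullet> C)) det (S C)\<close> is continuous on the whole compact set \<open>D\<close> and vanishes
where \<open>S C\<close> is singular, whereas its logarithm would be \<open>- \<infinity>\<close> there. As \<open>f 0 > 0\<close>, a maximiser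
gives a positive definite \<open>S C\<close>. Then small changes of the single entry \<open>(p, q)\<close> of \<open>C\<close> stay in
\<open>D\<close>, and the derivative of \<open>f\<close> in this direction is \<open>2 f C\<close> times the sum of the entries of \<open>m\<close>
and of the off-diagonal block of the inverse.\<close>

theorem exists_covariance_with_marginals:
  fixes A B m :: "real^'n^'n"
  assumes A: "A \<in> spd" and B: "B \<in> spd"
  obtains S where "S \<in> spd" and "block11 S = A" and "block22 S = B"
    and "block12 (matrix_inv S) = - m"
proof -
  define S where "S C = block_matrix A C (transpose C) B" for C
  define D where "D = {C. \<forall>z. 0 \<le> z \<bullet> (S C *v z)}"
  define f where "f C = exp (2 * (m \<bullet> C)) * det (S C)" for C
  have form: "stack x y \<bullet> (S C *v stack x y) = x \<bullet> (A *v x) + 2 * (x \<bullet> (C *v y)) + y \<bullet> (B *v y)" for x y C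
    unfolding S_def by (rule block_matrix_quadratic_form)
  have D_iff: "C \<in> D \<longleftrightarrow> (\<forall>x y. 0 \<le> x \<bullet> (A *v x) + 2 * (x \<bullet> (C *v y)) + y \<bullet> (B *v y))" for C
    unfolding D_def form[symmetric] by (auto, metis stack_cases)
  have sym: "transpose (S C) = S C" for C
    by (simp add: S_def transpose_block_matrix spd_sym[OF A] spd_sym[OF B])
  have "closed D"
  proof -
    have "D = (\<Inter>x. \<Inter>y. {C. 0 \<le> x \<bullet> (A *v x) + 2 * (x \<bullet> (C *v y)) + y \<bullet> (B *v y)})"
      by (auto simp: D_iff)
    moreover have "closed {C. 0 \<le> x \<bullet> (A *v x) + 2 * (x \<bullet> (C *v y)) + y \<bullet> (B *v y)}" for x y
    proof -
      have "linear (\<lambda>C. x \<bullet> (C *v y))"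
        by (rule linearI) (simp_all add: matrix_vector_mult_add_rdistrib
            scaleR_matrix_vector_assoc[symmetric] inner_add_right)
      from linear_continuous_on[OF this[unfolded linear_conv_bounded_linear]]
      show ?thesis by (intro closed_Collect_le continuous_on_add continuous_on_mult continuous_on_const)
    qed
    ultimately show ?thesis by auto
  qed
  moreover have "bounded D"
  proof -
    have entry: "\<bar>C $ i $ j\<bar> \<le> A $ i $ i + B $ j $ j" if "C \<in> D" for C i j
    proof -
      have ax: "axis i 1 \<bullet> (Q *v axis j s) = s * Q $ i $ j" for Q :: "real^'n^'n" and i j and s :: real
        by (simp add: inner_axis' matrix_vector_mul_component inner_axis)
      have ax': "axis j s \<bullet> (Q *v axis j s) = s\<^sup>2 * Q $ j $ j" for Q :: "real^'n^'n" and j and s :: real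
        by (simp add: inner_axis' matrix_vector_mul_component inner_axis power2_eq_square)
      have nn: "0 \<le> A $ i $ i" "0 \<le> B $ j $ j"
        using spd_nonneg[OF A, of "axis i 1"] spd_nonneg[OF B, of "axis j 1"] by (simp_all add: ax)
      have "0 \<le> A $ i $ i + 2 * (s * C $ i $ j) + s\<^sup>2 * B $ j $ j" for s
        using that[unfolded D_iff, rule_format, of "axis i 1" "axis j s"] by (simp add: ax ax')
      \<comment> \<open>the signs \<open>s = 1\<close> and \<open>s = -1\<close> bound the entry from below and from above\<close>
      from this[of 1] this[of "-1"] nn show ?thesis by (simp add: abs_if)
    qed
    have "norm C \<le> (\<Sum>i\<in>UNIV. \<Sum>j\<in>UNIV. A $ i $ i + B $ j $ j)" if "C \<in> D" for C
    proof -
      have "norm C \<le> (\<Sum>i\<in>UNIV. norm (C $ i))"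
        unfolding norm_vec_def[of C] by (rule L2_set_le_sum) simp
      also have "\<dots> \<le> (\<Sum>i\<in>UNIV. \<Sum>j\<in>UNIV. A $ i $ i + B $ j $ j)"
        by (intro sum_mono order_trans[OF norm_le_l1_cart] entry that)
      finally show ?thesis .
    qed
    then show ?thesis by (auto simp: bounded_iff)
  qed
  ultimately have "compact D" by (simp add: compact_eq_bounded_closed)
  moreover have S0: "S 0 \<in> spd" unfolding S_def by (rule spd_block_diagonal[OF A B])
  then have "0 \<in> D" by (simp add: D_def spd_nonneg)
  moreover have "continuous_on D f"
  proof -
    have "continuous_on D (\<lambda>C. S C $ a $ b)" for a b
      by (cases a; cases b) (auto simp: S_def transpose_def intro!: continuous_intros)
    then have "continuous_on D (\<lambda>C. det (S C))" by (rule det_continuous_on)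
    then show ?thesis unfolding f_def[abs_def] by (intro continuous_intros)
  qed
  ultimately obtain C where "C \<in> D" and max: "\<And>C'. C' \<in> D \<Longrightarrow> f C' \<le> f C"
    using continuous_attains_sup[of D f] by blast
  have "0 < f 0" using spd_det_pos[OF S0] by (simp add: f_def)
  also have "f 0 \<le> f C" by (rule max[OF \<open>0 \<in> D\<close>])
  finally have det: "0 < det (S C)" by (simp add: f_def zero_less_mult_iff)
  have SC: "S C \<in> spd"
    by (rule spd_of_semidefinite[OF sym]) (use \<open>C \<in> D\<close> det in \<open>auto simp: D_def\<close>)
  define P where "P = matrix_inv (S C)"
  have PS: "P ** S C = mat 1" unfolding P_def by (rule spd_inv_left[OF SC])
  have "P $ Inl p $ Inr q = - m $ p $ q" for p q
  proof -
    have "transpose P = P" unfolding P_def by (rule spd_sym[OF spd_matrix_inv[OF SC]])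
    from arg_cong[OF this, of "\<lambda>Q. Q $ Inl p $ Inr q"]
    have Psym: "P $ Inr q $ Inl p = P $ Inl p $ Inr q"
      by (simp add: transpose_def)
    define E :: "real^'n^'n" where "E = axis p (axis q 1)"
    have S_add: "S (C + t *\<^sub>R E) =
        S C + t *\<^sub>R (axis (Inl p) (axis (Inr q) 1) + axis (Inr q) (axis (Inl p) 1))" for t
      by (auto simp: S_def E_def vec_sum_eq_iff transpose_def axis_def)
    obtain c where c: "\<And>t. det (S (C + t *\<^sub>R E)) =
        det (S C) + t * ((P $ Inr q $ Inl p + P $ Inl p $ Inr q) * det (S C)) + t\<^sup>2 * c"
      unfolding S_add by (rule det_symmetric_perturbation[OF PS, of "Inl p" "Inr q"]) auto
    have mE: "m \<bullet> E = m $ p $ q" by (simp add: E_def inner_axis)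
    define h where "h t = exp (2 * (m \<bullet> C) + 2 * (t * m $ p $ q)) *
        (det (S C) + t * (2 * P $ Inl p $ Inr q * det (S C)) + t\<^sup>2 * c)" for t
    have h: "h t = f (C + t *\<^sub>R E)" for t
      by (simp add: h_def f_def c Psym inner_add_right mE algebra_simps)
    obtain d where "0 < d" and d: "\<And>z. d * (z \<bullet> z) \<le> z \<bullet> (S C *v z)"
      using spd_lower_bound[OF SC] by blast
    have feasible: "C + t *\<^sub>R E \<in> D" if "\<bar>t\<bar> < d" for t
      unfolding D_iff
    proof (intro allI)
      fix x y :: "real^'n"
      have "E *v y = axis p (y $ q)"
        by (auto simp: E_def matrix_mult_dot vec_eq_iff axis_def[of p] inner_axis')
      then have "x \<bullet> (E *v y) = x $ p * y $ q" by (simp add: inner_axis)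
      moreover have "2 * \<bar>x $ p * y $ q\<bar> \<le> x \<bullet> x + y \<bullet> y"
      proof -
        have "\<bar>x $ p * y $ q\<bar> \<le> norm x * norm y"
          unfolding abs_mult by (intro mult_mono component_le_norm_cart) auto
        moreover have "2 * (norm x * norm y) \<le> x \<bullet> x + y \<bullet> y"
          using sum_squares_bound[of "norm x" "norm y"] by (simp add: power2_norm_eq_inner)
        ultimately show ?thesis by simp
      qed
      then have "\<bar>t\<bar> * (2 * \<bar>x $ p * y $ q\<bar>) \<le> d * (x \<bullet> x + y \<bullet> y)"
        using that by (intro mult_mono) auto
      moreover have "- (\<bar>t\<bar> * \<bar>x $ p * y $ q\<bar>) \<le> t * (x $ p * y $ q)"
        by (metis abs_ge_minus_self abs_mult minus_le_iff)
      moreover have "d * (x \<bullet> x + y \<bullet> y) \<le> x \<bullet> (A *v x) + 2 * (x \<bullet> (C *v y)) + y \<bullet> (B *v y)"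
        using d[of "stack x y"] by (simp add: form stack_inner)
      ultimately show "0 \<le> x \<bullet> (A *v x) + 2 * (x \<bullet> ((C + t *\<^sub>R E) *v y)) + y \<bullet> (B *v y)"
        by (simp add: matrix_vector_mult_add_rdistrib scaleR_matrix_vector_assoc[symmetric] inner_add_right)
    qed
    have "(h has_real_derivative
        exp (2 * (m \<bullet> C)) * (2 * m $ p $ q * det (S C) + 2 * P $ Inl p $ Inr q * det (S C))) (at 0)"
      unfolding h_def[abs_def] by (auto intro!: derivative_eq_intros simp: algebra_simps)
    moreover have "\<forall>t. \<bar>0 - t\<bar> < d \<longrightarrow> h t \<le> h 0"
      using max feasible by (simp add: h)
    ultimately have "exp (2 * (m \<bullet> C)) * (2 * m $ p $ q * det (S C) + 2 * P $ Inl p $ Inr q * det (S C)) = 0"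
      using DERIV_local_max[OF _ \<open>0 < d\<close>] by blast
    then have "2 * m $ p $ q * det (S C) + 2 * P $ Inl p $ Inr q * det (S C) = 0"
      by (simp only: mult_eq_0_iff exp_not_eq_zero simp_thms)
    then have "(m $ p $ q + P $ Inl p $ Inr q) * det (S C) = 0" by (simp add: distrib_right)
    then show ?thesis using det by simp
  qed
  then have "block12 (matrix_inv (S C)) = - m"
    by (simp add: block12_def vec_eq_iff P_def)
  moreover have "block11 (S C) = A" "block22 (S C) = B"
    by (simp_all add: S_def block11_def block22_def vec_eq_iff)
  ultimately show ?thesis using that SC by blast
qed

section \<open>Strong duality\<close>

theorem proposition3p2:
  fixes A B :: "real^'n^'n" and \<Sigma> :: "real^('n + 'n)^('n + 'n)" and \<epsilon> :: real
  assumes "A \<in> spd" and "B \<in> spd" and "\<Sigma> \<in> spd" and "\<epsilon> > 0"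
  shows "\<exists>F G.
    is_arg_max (\<lambda>(F, G). dual_objective \<epsilon> \<Sigma> A B F G) (\<lambda>(F, G). F \<in> spd \<and> G \<in> spd) (F, G) \<and>
    eot \<epsilon> \<Sigma> (gaussian A) (gaussian B) =
      dual_objective \<epsilon> \<Sigma> A B F G
      + ereal (\<epsilon> * (hs_inner (block11 (matrix_inv \<Sigma>)) A + hs_inner (block22 (matrix_inv \<Sigma>)) B
                    - ln (det (\<epsilon> *\<^sub>R matrix_inv \<Sigma>))))"
proof -
  define M where "M = mat 1 - \<epsilon> *\<^sub>R block12 (matrix_inv \<Sigma>)"
  define const where "const = \<epsilon> * (hs_inner (block11 (matrix_inv \<Sigma>)) A + hs_inner (block22 (matrix_inv \<Sigma>)) B
                    - ln (det (\<epsilon> *\<^sub>R matrix_inv \<Sigma>)))"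
  have dual: "dual_objective \<epsilon> \<Sigma> A B F G =
      (if block_matrix F (- M) (- transpose M) G \<in> spd then ereal (dual_value \<epsilon> \<Sigma> A B F G - const) else - \<infinity>)" for F G
    using \<open>\<epsilon> > 0\<close> by (simp add: dual_objective_def dual_value_def Let_def logdet_def M_def const_def)
  \<comment> \<open>the covariance of the optimal coupling; the optimal \<open>F\<close> and \<open>G\<close> are read off from its inverse\<close>
  obtain S where S: "S \<in> spd" "block11 S = A" "block22 S = B"
    and S12: "block12 (matrix_inv S) = - ((1 / \<epsilon>) *\<^sub>R M)"
    using exists_covariance_with_marginals[OF assms(1,2), of "(1 / \<epsilon>) *\<^sub>R M"] by metis
  define K where "K = \<epsilon> *\<^sub>R matrix_inv S"
  have K: "K \<in> spd" unfolding K_def by (intro spd_scaleR spd_matrix_inv S \<open>\<epsilon> > 0\<close>)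
  define F where "F = block11 K"
  define G where "G = block22 K"
  have "block12 K = \<epsilon> *\<^sub>R block12 (matrix_inv S)"
    by (simp add: K_def block12_def vec_eq_iff)
  also have "\<dots> = - M" using \<open>\<epsilon> > 0\<close> by (simp add: S12)
  finally have K12: "block12 K = - M" .
  have "transpose (- M) = - transpose M" by (simp add: transpose_def vec_eq_iff)
  then have K_eq: "K = block_matrix F (- M) (- transpose M) G"
    using block_matrix_symmetric[OF spd_sym[OF K]] by (simp add: K12 F_def G_def)
  have FG: "F \<in> spd" "G \<in> spd" unfolding F_def G_def using K by (rule spd_block11 spd_block22)+
  have S_eq: "S = \<epsilon> *\<^sub>R matrix_inv K"
  proof -
    have "matrix_inv K = (1 / \<epsilon>) *\<^sub>R S"
      by (rule matrix_inv_unique)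
        (use \<open>\<epsilon> > 0\<close> in \<open>simp add: K_def matrix_scalar_ac scalar_matrix_assoc[symmetric] spd_inv_left[OF S(1)]\<close>)
    then show ?thesis using \<open>\<epsilon> > 0\<close> by simp
  qed
  have \<pi>: "gaussian_prod S \<in> couplings (gaussian A) (gaussian B)"
    using gaussian_prod_marginals[OF S(1)] prob_space_gaussian_prod[OF S(1)] S(2,3)
    by (simp add: couplings_def)
  have attained: "transport_objective \<epsilon> \<Sigma> (gaussian_prod S) = ereal (dual_value \<epsilon> \<Sigma> A B F G)"
    using gaussian_prod_attains_dual_value[OF assms, of F G S] K \<pi> S_eq
    unfolding K_eq M_def by blast
  have lower: "ereal (dual_value \<epsilon> \<Sigma> A B F' G') \<le> transport_objective \<epsilon> \<Sigma> \<pi>"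
    if "block_matrix F' (- M) (- transpose M) G' \<in> spd" "\<pi> \<in> couplings (gaussian A) (gaussian B)" for F' G' \<pi>
    using weak_duality[OF assms that(1)[unfolded M_def] that(2)] .
  have "eot \<epsilon> \<Sigma> (gaussian A) (gaussian B) =
      (INF \<pi>\<in>couplings (gaussian A) (gaussian B). transport_objective \<epsilon> \<Sigma> \<pi>)"
    by (simp add: eot_def transport_objective_def)
  also have "\<dots> = ereal (dual_value \<epsilon> \<Sigma> A B F G)"
  proof (rule antisym)
    show "(INF \<pi>\<in>couplings (gaussian A) (gaussian B). transport_objective \<epsilon> \<Sigma> \<pi>) \<le> ereal (dual_value \<epsilon> \<Sigma> A B F G)"
      unfolding attained[symmetric] by (rule INF_lower[OF \<pi>])
    show "ereal (dual_value \<epsilon> \<Sigma> A B F G) \<le> (INF \<pi>\<in>couplings (gaussian A) (gaussian B). transport_objective \<epsilon> \<Sigma> \<pi>)"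
      using K unfolding K_eq by (intro INF_greatest lower)
  qed
  also have "\<dots> = dual_objective \<epsilon> \<Sigma> A B F G + ereal const"
    using K unfolding K_eq by (simp add: dual)
  finally have optimum: "eot \<epsilon> \<Sigma> (gaussian A) (gaussian B) = dual_objective \<epsilon> \<Sigma> A B F G + ereal const" .
  have "dual_objective \<epsilon> \<Sigma> A B F' G' \<le> dual_objective \<epsilon> \<Sigma> A B F G" for F' G'
    using lower[OF _ \<pi>, of F' G'] K unfolding K_eq attained by (simp add: dual)
  then have "is_arg_max (\<lambda>(F, G). dual_objective \<epsilon> \<Sigma> A B F G) (\<lambda>(F, G). F \<in> spd \<and> G \<in> spd) (F, G)"
    using FG by (auto simp: is_arg_max_linorder)
  then show ?thesis using optimum unfolding const_def by blast
qed

end
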